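(* Let $G=GL(m|n)$ over a field $K$ of characteristic $p>2$, and equip $Dist(G)\subseteq K[G]^*$ with the topology induced from the pseudocompact topology of $K[G]^*$. A two-sided superideal $I$ of $Dist(G)$ is open if and only if $I$ contains an intersection of finitely many superideals $\ker\pi_{l,s}$ ($l,s\ge0$).
   Context: $K$ is a field of characteristic $p>2$, $G=GL(m|n)$, $K[G]$ its coordinate Hopf superalgebra with matrix generators $x_{ij}$ ($1\le i,j\le m+n$, $x_{ij}$ even iff $i,j\le m$ or $i,j>m$), antipode $s_G$, $x^{(-1)}_{ij}=s_G(x_{ij})$. For a supercoalgebra $C$, $C^*$ is a superalgebra with product $\phi\psi(c)=\sum(-1)^{|\psi||c_1|}\phi(c_1)\psi(c_2)$; its pseudocompact topology has as basis of neighborhoods of zero the superideals $D^\perp=\{\phi\in C^*\mid\phi(D)=0\}$, with $D$ running over finite-dimensional subsupercoalgebras of $C$. Thus the induced topology on $Dist(G)$ has basis of neighborhoods of zero $Dist(G)\cap D^\perp$, $D\subseteq K[G]$ a finite-dimensional subsupercoalgebra. $Dist(G)=\bigcup_{t\ge0}(K[G]/\mathfrak m^{t+1})^*\subseteq K[G]^*$ is the distribution superalgebra, where $\mathfrak m=\ker\epsilon_G$. For $l,s\ge 0$, $C_{l,s}\subseteq K[G]$ is the span of all products of $l$ of the elements $x_{ij}$ and $s$ of the elements $x^{(-1)}_{ij}$; equivalently $C_{l,s}=\mathrm{cf}(V^{\otimes l}\otimes(V^* )^{\otimes s})$ is the coefficient space, with $V$ the natural $G$-supermodule of superdimension $m|n$.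 It is a finite-dimensional subsupercoalgebra. $S_{l,s}=C_{l,s}^*$ and $\pi_{l,s}:Dist(G)\to S_{l,s}$ is the superalgebra morphism $\xi\mapsto\xi|_{C_{l,s}}$. *)

theory Defs
  imports
    "HOL-Library.Function_Algebras"
    "HOL-Combinatorics.Permutations"
    "HOL-Analysis.Abstract_Topology"
begin

section \<open>Superspaces and superalgebras\<close>

text \<open>
  A superspace, superalgebra, supercoalgebra or Hopf superalgebra over the field \<open>'k\<close> has
  the type \<open>'a\<close> as its underlying ring; the remaining data form a record. Parities are booleans:
  \<open>gr H False\<close> is the even and \<open>gr H True\<close> the odd part, and
  \<open>p \<noteq> q\<close> is the sum of the parities \<open>p\<close> and \<open>q\<close>.
\<close>

record ('k, 'a) superdata =
  sc :: "'k \<Rightarrow> 'a \<Rightarrow> 'a"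
  gr :: "bool \<Rightarrow> 'a set"

record ('k, 'a) coalg_data = "('k, 'a) superdata" +
  comult :: "'a \<Rightarrow> ('a \<Rightarrow> 'a \<Rightarrow> 'k) \<Rightarrow> 'k"  \<comment> \<open>values in \<open>tensor_sq\<close> below\<close>
  counit :: "'a \<Rightarrow> 'k"

record ('k, 'a) hopf_data = "('k, 'a) coalg_data" +
  antip :: "'a \<Rightarrow> 'a"

definition superspace :: "('k::field, 'a::ab_group_add, 'z) superdata_scheme \<Rightarrow> bool" where
  "superspace H \<longleftrightarrow>
     vector_space (sc H) \<and>
     (\<forall>p. module.subspace (sc H) (gr H p)) \<and>
     (\<forall>a. \<exists>!b. b \<in> gr H False \<and> a - b \<in> gr H True)"

text \<open>Homogeneous component of parity \<open>p\<close>.\<close>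

definition hcomp :: "('k, 'a::ab_group_add, 'z) superdata_scheme \<Rightarrow> bool \<Rightarrow> 'a \<Rightarrow> 'a" where
  "hcomp H p a = (THE b. b \<in> gr H p \<and> a - b \<in> gr H (\<not> p))"

definition ksign :: "bool \<Rightarrow> bool \<Rightarrow> 'k::ring_1" where
  "ksign p q = (if p \<and> q then - 1 else 1)"

definition superalgebra :: "('k::field, 'a::ring_1, 'z) superdata_scheme \<Rightarrow> bool" where
  "superalgebra H \<longleftrightarrow>
     superspace H \<and>
     (\<forall>k a b. sc H k (a * b) = sc H k a * b \<and> sc H k (a * b) = a * sc H k b) \<and>
     1 \<in> gr H False \<and>
     (\<forall>p q. \<forall>a\<in>gr H p. \<forall>b\<in>gr H q. a * b \<in> gr H (p \<noteq> q))"

definition supercommutative :: "('k::field, 'a::ring_1, 'z) superdata_scheme \<Rightarrow> bool" where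
  "supercommutative H \<longleftrightarrow>
     (\<forall>p q. \<forall>a\<in>gr H p. \<forall>b\<in>gr H q. a * b = sc H (ksign p q) (b * a))"


section \<open>Tensor square\<close>

text \<open>
  We use the standard model of \<open>A \<otimes> A\<close> as the space of functionals on the bilinear forms
  \<open>A \<times> A \<rightarrow> K\<close> spanned by the evaluations \<open>a \<otimes> b = (\<beta> \<mapsto> \<beta> a b)\<close>.
  So if \<open>t\<close> is the tensor \<open>\<Sum>\<^sub>i a\<^sub>i \<otimes> b\<^sub>i\<close> and \<open>\<beta>\<close> is bilinear,
  then \<open>t \<beta> = \<Sum>\<^sub>i \<beta> a\<^sub>i b\<^sub>i\<close>. Arguments that are not bilinear are sent to \<open>0\<close>,
  which makes equality of tensors coincide with equality of functions.
\<close>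

definition lin_form :: "('k::field, 'a::ab_group_add, 'z) superdata_scheme \<Rightarrow> ('a \<Rightarrow> 'k) \<Rightarrow> bool" where
  "lin_form H \<phi> \<longleftrightarrow> Vector_Spaces.linear (sc H) (*) \<phi>"

definition bilin_form ::
    "('k::field, 'a::ab_group_add, 'z) superdata_scheme \<Rightarrow> ('a \<Rightarrow> 'a \<Rightarrow> 'k) \<Rightarrow> bool" where
  "bilin_form H \<beta> \<longleftrightarrow> (\<forall>a. lin_form H (\<lambda>b. \<beta> a b)) \<and> (\<forall>b. lin_form H (\<lambda>a. \<beta> a b))"

definition trilin_form ::
    "('k::field, 'a::ab_group_add, 'z) superdata_scheme \<Rightarrow> ('a \<Rightarrow> 'a \<Rightarrow> 'a \<Rightarrow> 'k) \<Rightarrow> bool" where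
  "trilin_form H \<gamma> \<longleftrightarrow>
     (\<forall>a. bilin_form H (\<lambda>b c. \<gamma> a b c)) \<and> (\<forall>b c. lin_form H (\<lambda>a. \<gamma> a b c))"

definition fscale :: "'k::field \<Rightarrow> ('b \<Rightarrow> 'k) \<Rightarrow> 'b \<Rightarrow> 'k" where
  "fscale k f = (\<lambda>x. k * f x)"

definition tensor :: "('k::field, 'a::ab_group_add, 'z) superdata_scheme \<Rightarrow>
    'a \<Rightarrow> 'a \<Rightarrow> ('a \<Rightarrow> 'a \<Rightarrow> 'k) \<Rightarrow> 'k" where
  "tensor H a b = (\<lambda>\<beta>. if bilin_form H \<beta> then \<beta> a b else 0)"

text \<open>For subspaces \<open>U\<close>, \<open>W\<close> of \<open>A\<close>: the subspace \<open>U \<otimes> W\<close> of \<open>A \<otimes> A\<close>.\<close>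

definition tensor_sub :: "('k::field, 'a::ab_group_add, 'z) superdata_scheme \<Rightarrow>
    'a set \<Rightarrow> 'a set \<Rightarrow> (('a \<Rightarrow> 'a \<Rightarrow> 'k) \<Rightarrow> 'k) set" where
  "tensor_sub H U W = module.span fscale {tensor H a b | a b. a \<in> U \<and> b \<in> W}"

abbreviation tensor_sq :: "('k::field, 'a::ab_group_add, 'z) superdata_scheme \<Rightarrow>
    (('a \<Rightarrow> 'a \<Rightarrow> 'k) \<Rightarrow> 'k) set" where
  "tensor_sq H \<equiv> tensor_sub H UNIV UNIV"

definition tensor_gr :: "('k::field, 'a::ab_group_add, 'z) superdata_scheme \<Rightarrow>
    bool \<Rightarrow> (('a \<Rightarrow> 'a \<Rightarrow> 'k) \<Rightarrow> 'k) set" where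
  "tensor_gr H p =
     module.span fscale {tensor H a b | a b q r. a \<in> gr H q \<and> b \<in> gr H r \<and> (q \<noteq> r) = p}"

text \<open>
  The product of the superalgebra \<open>A \<otimes> A\<close>, i.e. the bilinear extension of
  \<open>(a \<otimes> b)(c \<otimes> d) = (-1)\<^bsup>|b||c|\<^esup> ac \<otimes> bd\<close>; see \<open>tmult_tensor\<close> below.
\<close>

definition tmult :: "('k::field, 'a::ring_1, 'z) superdata_scheme \<Rightarrow>
    (('a \<Rightarrow> 'a \<Rightarrow> 'k) \<Rightarrow> 'k) \<Rightarrow> (('a \<Rightarrow> 'a \<Rightarrow> 'k) \<Rightarrow> 'k) \<Rightarrow> ('a \<Rightarrow> 'a \<Rightarrow> 'k) \<Rightarrow> 'k" where
  "tmult H t u = (\<lambda>\<beta>. if bilin_form H \<beta>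
     then t (\<lambda>a b. u (\<lambda>c d.
       \<Sum>p\<in>UNIV. \<Sum>q\<in>UNIV. ksign p q * \<beta> (a * hcomp H q c) (hcomp H p b * d)))
     else 0)"


section \<open>Supercoalgebras and Hopf superalgebras\<close>

text \<open>
  The counit and antipode axioms are stated in Sweedler form, for an arbitrary presentation
  \<open>\<Delta>(c) = \<Sum> c\<^sub>1 \<otimes> c\<^sub>2\<close>. Coassociativity is the equality of the elements
  \<open>\<Sum> \<Delta>(c\<^sub>1) \<otimes> c\<^sub>2\<close> and \<open>\<Sum> c\<^sub>1 \<otimes> \<Delta>(c\<^sub>2)\<close> of \<open>A \<otimes> A \<otimes> A\<close>, modelled by functionals
  on trilinear forms.
\<close>

definition sweedler :: "('k::field, 'a::ab_group_add, 'z) coalg_data_scheme \<Rightarrow>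
    'a \<Rightarrow> ('a \<times> 'a) list \<Rightarrow> bool" where
  "sweedler H c ts \<longleftrightarrow> comult H c = (\<Sum>(a, b)\<leftarrow>ts. tensor H a b)"

definition supercoalgebra :: "('k::field, 'a::ab_group_add, 'z) coalg_data_scheme \<Rightarrow> bool" where
  "supercoalgebra H \<longleftrightarrow>
     superspace H \<and>
     Vector_Spaces.linear (sc H) fscale (comult H) \<and>
     (\<forall>p. \<forall>c\<in>gr H p. comult H c \<in> tensor_gr H p) \<and>
     lin_form H (counit H) \<and>
     (\<forall>c\<in>gr H True. counit H c = 0) \<and>
     (\<forall>c \<gamma>. trilin_form H \<gamma> \<longrightarrow>
        comult H c (\<lambda>a b. comult H a (\<lambda>a' a''. \<gamma> a' a'' b)) =
        comult H c (\<lambda>a b. comult H b (\<lambda>b' b''. \<gamma> a b' b''))) \<and>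
     (\<forall>c ts. sweedler H c ts \<longrightarrow>
        (\<Sum>(a, b)\<leftarrow>ts. sc H (counit H a) b) = c \<and>
        (\<Sum>(a, b)\<leftarrow>ts. sc H (counit H b) a) = c)"

definition hopf_superalgebra :: "('k::field, 'a::ring_1, 'z) hopf_data_scheme \<Rightarrow> bool" where
  "hopf_superalgebra H \<longleftrightarrow>
     superalgebra H \<and> supercoalgebra H \<and>
     comult H 1 = tensor H 1 1 \<and>
     (\<forall>a b. comult H (a * b) = tmult H (comult H a) (comult H b)) \<and>
     counit H 1 = 1 \<and>
     (\<forall>a b. counit H (a * b) = counit H a * counit H b) \<and>
     Vector_Spaces.linear (sc H) (sc H) (antip H) \<and>
     (\<forall>p. antip H ` gr H p \<subseteq> gr H p) \<and>
     (\<forall>c ts. sweedler H c ts \<longrightarrow>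
        (\<Sum>(a, b)\<leftarrow>ts. antip H a * b) = sc H (counit H c) 1 \<and>
        (\<Sum>(a, b)\<leftarrow>ts. a * antip H b) = sc H (counit H c) 1)"

definition fin_dim :: "('k::field, 'a::ab_group_add, 'z) superdata_scheme \<Rightarrow> 'a set \<Rightarrow> bool" where
  "fin_dim H D \<longleftrightarrow> (\<exists>B. finite B \<and> D = module.span (sc H) B)"

definition subsupercoalgebra ::
    "('k::field, 'a::ab_group_add, 'z) coalg_data_scheme \<Rightarrow> 'a set \<Rightarrow> bool" where
  "subsupercoalgebra H D \<longleftrightarrow>
     module.subspace (sc H) D \<and>
     (\<forall>p. \<forall>d\<in>D. hcomp H p d \<in> D) \<and>
     (\<forall>d\<in>D. comult H d \<in> tensor_sub H D D)"


section \<open>The dual superalgebra and its pseudocompact topology\<close>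

definition dual :: "('k::field, 'a::ab_group_add, 'z) superdata_scheme \<Rightarrow> ('a \<Rightarrow> 'k) set" where
  "dual H = {\<phi>. lin_form H \<phi>}"

text \<open>A functional is homogeneous of parity \<open>p\<close> if it vanishes on the part of parity \<open>\<not> p\<close>.\<close>

definition dual_hcomp :: "('k::field, 'a::ab_group_add, 'z) superdata_scheme \<Rightarrow>
    bool \<Rightarrow> ('a \<Rightarrow> 'k) \<Rightarrow> 'a \<Rightarrow> 'k" where
  "dual_hcomp H p \<phi> = (\<lambda>a. \<phi> (hcomp H p a))"

text \<open>\<open>\<phi>\<psi>(c) = \<Sum> (-1)\<^bsup>|\<psi>||c\<^sub>1|\<^esup> \<phi>(c\<^sub>1) \<psi>(c\<^sub>2)\<close>, extended from homogeneous \<open>\<psi>\<close>, \<open>c\<^sub>1\<close> by linearity.\<close>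

definition dual_mult :: "('k::field, 'a::ab_group_add, 'z) coalg_data_scheme \<Rightarrow>
    ('a \<Rightarrow> 'k) \<Rightarrow> ('a \<Rightarrow> 'k) \<Rightarrow> 'a \<Rightarrow> 'k" where
  "dual_mult H \<phi> \<psi> = (\<lambda>c. comult H c (\<lambda>a b.
     \<Sum>p\<in>UNIV. \<Sum>q\<in>UNIV. ksign q p * \<phi> (hcomp H p a) * dual_hcomp H q \<psi> b))"

definition perp :: "('k::field, 'a::ab_group_add, 'z) superdata_scheme \<Rightarrow>
    'a set \<Rightarrow> ('a \<Rightarrow> 'k) set" where
  "perp H D = {\<phi> \<in> dual H. \<forall>d\<in>D. \<phi> d = 0}"

definition dual_open :: "('k::field, 'a::ab_group_add, 'z) coalg_data_scheme \<Rightarrow>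
    ('a \<Rightarrow> 'k) set \<Rightarrow> bool" where
  "dual_open H U \<longleftrightarrow>
     U \<subseteq> dual H \<and>
     (\<forall>\<phi>\<in>U. \<exists>D. subsupercoalgebra H D \<and> fin_dim H D \<and> (\<forall>\<psi>\<in>perp H D. \<phi> + \<psi> \<in> U))"

definition dual_topology ::
    "('k::field, 'a::ab_group_add, 'z) coalg_data_scheme \<Rightarrow> ('a \<Rightarrow> 'k) topology" where
  "dual_topology H = topology (dual_open H)"

text \<open>Two-sided superideals of a subsuperalgebra \<open>R\<close> of the dual superalgebra.\<close>

definition dual_superideal :: "('k::field, 'a::ab_group_add, 'z) coalg_data_scheme \<Rightarrow>
    ('a \<Rightarrow> 'k) set \<Rightarrow> ('a \<Rightarrow> 'k) set \<Rightarrow> bool" where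
  "dual_superideal H R I \<longleftrightarrow>
     I \<subseteq> R \<and> module.subspace fscale I \<and>
     (\<forall>\<phi>\<in>I. \<forall>\<xi>\<in>R. dual_mult H \<xi> \<phi> \<in> I \<and> dual_mult H \<phi> \<xi> \<in> I) \<and>
     (\<forall>p. \<forall>\<phi>\<in>I. dual_hcomp H p \<phi> \<in> I)"


section \<open>Distributions\<close>

text \<open>The \<open>(t+1)\<close>-st power of the ideal \<open>\<mm> = ker \<epsilon>\<close>.\<close>

definition aug_ideal_power ::
    "('k::field, 'a::ring_1, 'z) coalg_data_scheme \<Rightarrow> nat \<Rightarrow> 'a set" where
  "aug_ideal_power H t =
     module.span (sc H) {prod_list as | as. length as = Suc t \<and> (\<forall>a\<in>set as. counit H a = 0)}"

text \<open>\<open>(A/\<mm>\<^bsup>t+1\<^esup>)\<^sup>*\<close> is the set of functionals on \<open>A\<close> vanishing on \<open>\<mm>\<^bsup>t+1\<^esup>\<close>.\<close>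

definition Dist :: "('k::field, 'a::ring_1, 'z) coalg_data_scheme \<Rightarrow> ('a \<Rightarrow> 'k) set" where
  "Dist H = (\<Union>t. perp H (aug_ideal_power H t))"


section \<open>The coordinate Hopf superalgebra of the general linear supergroup\<close>

text \<open>Indices run through \<open>{..<m+n}\<close>; the first \<open>m\<close> of them are even.\<close>

definition idx_par :: "nat \<Rightarrow> nat \<Rightarrow> bool" where
  "idx_par m i \<longleftrightarrow> m \<le> i"

definition gen_par :: "nat \<Rightarrow> nat \<Rightarrow> nat \<Rightarrow> bool" where
  "gen_par m i j \<longleftrightarrow> idx_par m i \<noteq> idx_par m j"

text \<open>
  Standard monomials: \<open>\<Prod> x\<^sub>i\<^sub>j\<^bsup>e(i,j)\<^esup>\<close> in lexicographic order, where the odd generators occur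
  with exponent at most one. They form a basis of the free supercommutative superalgebra
  on the \<open>x\<^sub>i\<^sub>j\<close>.
\<close>

definition std_exps :: "nat \<Rightarrow> nat \<Rightarrow> (nat \<times> nat \<Rightarrow> nat) set" where
  "std_exps m n = {e. \<forall>i j.
     (\<not> (i < m + n \<and> j < m + n) \<longrightarrow> e (i, j) = 0) \<and> (gen_par m i j \<longrightarrow> e (i, j) \<le> 1)}"

definition std_monom :: "nat \<Rightarrow> nat \<Rightarrow> (nat \<Rightarrow> nat \<Rightarrow> 'a::ring_1) \<Rightarrow> (nat \<times> nat \<Rightarrow> nat) \<Rightarrow> 'a" where
  "std_monom m n x e =
     prod_list (map (\<lambda>(i, j). x i j ^ e (i, j)) (List.product [0..<m+n] [0..<m+n]))"

text \<open>Leibniz determinant of the block with rows and columns in \<open>{lo..<hi}\<close> (even, so commuting, entries).\<close>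

definition block_det :: "nat \<Rightarrow> nat \<Rightarrow> (nat \<Rightarrow> nat \<Rightarrow> 'a::ring_1) \<Rightarrow> 'a" where
  "block_det lo hi x =
     (\<Sum>\<pi> | \<pi> permutes {lo..<hi}. of_int (sign \<pi>) * prod_list (map (\<lambda>i. x i (\<pi> i)) [lo..<hi]))"

definition gl_det :: "nat \<Rightarrow> nat \<Rightarrow> (nat \<Rightarrow> nat \<Rightarrow> 'a::ring_1) \<Rightarrow> 'a" where
  "gl_det m n x = block_det 0 m x * block_det m (m + n) x"

text \<open>
  \<open>H\<close> with matrix generators \<open>x\<^sub>i\<^sub>j\<close> is \<open>K[GL(m|n)]\<close>: the underlying superalgebra is the
  localization of the free supercommutative superalgebra \<open>K[x\<^sub>i\<^sub>j]\<close> at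
  \<open>d = det(X\<^sub>0\<^sub>0) det(X\<^sub>1\<^sub>1)\<close> (that is, \<open>K[x\<^sub>i\<^sub>j]\<close> embeds, \<open>d\<close> becomes invertible, and every element
  is a fraction \<open>d\<^bsup>-r\<^esup> f\<close>), and \<open>\<Delta>(x\<^sub>i\<^sub>j) = \<Sum>\<^sub>k x\<^sub>i\<^sub>k \<otimes> x\<^sub>k\<^sub>j\<close>, \<open>\<epsilon>(x\<^sub>i\<^sub>j) = \<delta>\<^sub>i\<^sub>j\<close>. This determines
  \<open>(H, x)\<close> up to unique isomorphism, the antipode being determined by the bialgebra structure.
\<close>

definition GL_coordinate_hopf_superalgebra ::
    "nat \<Rightarrow> nat \<Rightarrow> ('k::field, 'a::ring_1) hopf_data \<Rightarrow> (nat \<Rightarrow> nat \<Rightarrow> 'a) \<Rightarrow> bool" where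
  "GL_coordinate_hopf_superalgebra m n H x \<longleftrightarrow>
     hopf_superalgebra H \<and> supercommutative H \<and>
     (\<forall>i<m+n. \<forall>j<m+n. x i j \<in> gr H (gen_par m i j)) \<and>
     (\<forall>E c. finite E \<and> E \<subseteq> std_exps m n \<and> (\<Sum>e\<in>E. sc H (c e) (std_monom m n x e)) = 0 \<longrightarrow>
        (\<forall>e\<in>E. c e = 0)) \<and>
     (\<exists>d'. gl_det m n x * d' = 1 \<and> d' * gl_det m n x = 1) \<and>
     (\<forall>a. \<exists>r. gl_det m n x ^ r * a \<in> module.span (sc H) (std_monom m n x ` std_exps m n)) \<and>
     (\<forall>i<m+n. \<forall>j<m+n. comult H (x i j) = (\<Sum>k<m+n. tensor H (x i k) (x k j))) \<and>
     (\<forall>i<m+n. \<forall>j<m+n. counit H (x i j) = (if i = j then 1 else 0))"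

text \<open>The coefficient space \<open>C\<^bsub>l,s\<^esub>\<close>; here \<open>x\<^sub>i\<^sub>j\<^bsup>(-1)\<^esup> = antip H (x i j)\<close>.\<close>

definition coeff_space :: "nat \<Rightarrow> nat \<Rightarrow> ('k::field, 'a::ring_1) hopf_data \<Rightarrow>
    (nat \<Rightarrow> nat \<Rightarrow> 'a) \<Rightarrow> nat \<Rightarrow> nat \<Rightarrow> 'a set" where
  "coeff_space m n H x l s = module.span (sc H)
     {prod_list (map (\<lambda>(i, j). x i j) us) * prod_list (map (\<lambda>(i, j). antip H (x i j)) vs) | us vs.
        length us = l \<and> length vs = s \<and> set us \<union> set vs \<subseteq> {..<m+n} \<times> {..<m+n}}"

definition pi_ls :: "nat \<Rightarrow> nat \<Rightarrow> ('k::field, 'a::ring_1) hopf_data \<Rightarrow>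
    (nat \<Rightarrow> nat \<Rightarrow> 'a) \<Rightarrow> nat \<Rightarrow> nat \<Rightarrow> ('a \<Rightarrow> 'k) \<Rightarrow> 'a \<Rightarrow> 'k" where
  "pi_ls m n H x l s \<xi> = restrict \<xi> (coeff_space m n H x l s)"

definition ker_pi :: "nat \<Rightarrow> nat \<Rightarrow> ('k::field, 'a::ring_1) hopf_data \<Rightarrow>
    (nat \<Rightarrow> nat \<Rightarrow> 'a) \<Rightarrow> nat \<Rightarrow> nat \<Rightarrow> ('a \<Rightarrow> 'k) set" where
  "ker_pi m n H x l s =
     {\<xi> \<in> Dist H. pi_ls m n H x l s \<xi> = restrict (\<lambda>c. 0) (coeff_space m n H x l s)}"


section \<open>First consequences\<close>

lemma vector_space_fscale: "vector_space (fscale :: 'k::field \<Rightarrow> ('b \<Rightarrow> 'k) \<Rightarrow> 'b \<Rightarrow> 'k)"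
  by unfold_locales (auto simp: fscale_def plus_fun_def algebra_simps)

lemma hcomp_unique:
  assumes H: "superspace H" and b: "b \<in> gr H p" and c: "a - b \<in> gr H (\<not> p)"
  shows "hcomp H p a = b"
proof -
  have ex: "\<exists>!b. b \<in> gr H False \<and> a - b \<in> gr H True" using H unfolding superspace_def by blast
  have "b' = b" if b': "b' \<in> gr H p" "a - b' \<in> gr H (\<not> p)" for b'
  proof (cases p)
    case False
    then have "b \<in> gr H False \<and> a - b \<in> gr H True" "b' \<in> gr H False \<and> a - b' \<in> gr H True"
      using b c b' by simp_all
    then show ?thesis using ex by blast
  next
    case True
    then have "a - b \<in> gr H False \<and> a - (a - b) \<in> gr H True"
      "a - b' \<in> gr H False \<and> a - (a - b') \<in> gr H True"
      using b c b' by simp_all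
    then have "a - b = a - b'" using ex by blast
    then show ?thesis by simp
  qed
  then show ?thesis
    unfolding hcomp_def using b c by (intro the_equality) blast+
qed

lemma hcomp_mem:
  assumes H: "superspace H"
  shows "hcomp H p a \<in> gr H p" "a - hcomp H p a \<in> gr H (\<not> p)"
proof -
  obtain b where b: "b \<in> gr H False" "a - b \<in> gr H True" using H unfolding superspace_def by blast
  have "\<exists>b. b \<in> gr H p \<and> a - b \<in> gr H (\<not> p)"
  proof (cases p)
    case False
    with b show ?thesis by (intro exI[of _ b]) simp
  next
    case True
    with b show ?thesis by (intro exI[of _ "a - b"]) simp
  qed
  then obtain b' where b': "b' \<in> gr H p" "a - b' \<in> gr H (\<not> p)" by blast
  show "hcomp H p a \<in> gr H p" "a - hcomp H p a \<in> gr H (\<not> p)"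
    unfolding hcomp_unique[OF H b'] by (fact b')+
qed

lemma hcomp_hom:
  assumes H: "superspace H" and a: "a \<in> gr H p"
  shows "hcomp H q a = (if q = p then a else 0)"
proof -
  interpret vector_space "sc H" using H by (simp add: superspace_def)
  have sub: "subspace (gr H q)" for q using H by (simp add: superspace_def)
  have eq: "hcomp H p a = a"
    by (rule hcomp_unique[OF H a]) (simp add: subspace_0[OF sub])
  have "hcomp H (\<not> p) a = 0"
    by (rule hcomp_unique[OF H]) (simp_all add: subspace_0[OF sub] a)
  then show ?thesis using eq by (cases p; cases q; simp)
qed

lemma hcomp_linear:
  assumes H: "superspace H"
  shows "Vector_Spaces.linear (sc H) (sc H) (hcomp H p)"
proof -
  interpret vector_space "sc H" using H by (simp add: superspace_def)
  have sub: "subspace (gr H q)" for q using H by (simp add: superspace_def)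
  note mem = hcomp_mem[OF H]
  have add: "hcomp H p (a + b) = hcomp H p a + hcomp H p b" for a b
  proof (rule hcomp_unique[OF H])
    show "hcomp H p a + hcomp H p b \<in> gr H p"
      by (rule subspace_add[OF sub mem(1) mem(1)])
    show "a + b - (hcomp H p a + hcomp H p b) \<in> gr H (\<not> p)"
      unfolding add_diff_add by (rule subspace_add[OF sub mem(2) mem(2)])
  qed
  have scl: "hcomp H p (sc H k a) = sc H k (hcomp H p a)" for k a
  proof (rule hcomp_unique[OF H])
    show "sc H k (hcomp H p a) \<in> gr H p"
      by (rule subspace_scale[OF sub mem(1)])
    have "sc H k (a - hcomp H p a) \<in> gr H (\<not> p)"
      by (rule subspace_scale[OF sub mem(2)])
    then show "sc H k a - sc H k (hcomp H p a) \<in> gr H (\<not> p)"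
      by (simp only: scale_right_diff_distrib)
  qed
  show ?thesis
    unfolding Vector_Spaces.linear_iff using vector_space_axioms add scl by blast
qed

lemma lin_formI:
  assumes "vector_space (sc H)" "\<And>a b. f (a + b) = f a + f b" "\<And>k a. f (sc H k a) = k * f a"
  shows "lin_form H (f :: 'a::ab_group_add \<Rightarrow> 'k::field)"
proof -
  interpret vector_space "sc H" by fact
  interpret K: vector_space "(*) :: 'k \<Rightarrow> 'k \<Rightarrow> 'k" by unfold_locales (auto simp: algebra_simps)
  show ?thesis unfolding lin_form_def by unfold_locales (use assms in auto)
qed

lemma lin_form_add: "lin_form H f \<Longrightarrow> f (a + b) = f a + f b"
  unfolding lin_form_def by (simp add: Vector_Spaces.linear_iff)

lemma lin_form_scale: "lin_form H f \<Longrightarrow> f (sc H k a) = k * f a"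
  unfolding lin_form_def by (simp add: Vector_Spaces.linear_iff)

lemma lin_form_zero: "lin_form H f \<Longrightarrow> f 0 = 0"
  using lin_form_add[of H f 0 0] by (metis add.right_neutral add_left_cancel)

lemma tmult_tensor:
  fixes H :: "('k::field, 'a::ring_1, 'z) superdata_scheme"
  assumes H: "superalgebra H" and b: "b \<in> gr H p" and c: "c \<in> gr H q"
  shows "tmult H (tensor H a b) (tensor H c d) = fscale (ksign p q) (tensor H (a * c) (b * d))"
proof
  fix \<beta> :: "'a \<Rightarrow> 'a \<Rightarrow> 'k"
  have S: "superspace H" using H by (simp add: superalgebra_def)
  have V: "vector_space (sc H)" using S by (simp add: superspace_def)
  show "tmult H (tensor H a b) (tensor H c d) \<beta> =
        fscale (ksign p q) (tensor H (a * c) (b * d)) \<beta>"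
  proof (cases "bilin_form H \<beta>")
    case False
    then show ?thesis by (simp add: tmult_def fscale_def tensor_def)
  next
    case True
    have l1: "lin_form H (\<beta> u)" and l2: "lin_form H (\<lambda>u. \<beta> u v)" for u v
      using True by (auto simp: bilin_form_def)
    note lin = l1[THEN lin_form_add] l2[THEN lin_form_add]
      l1[THEN lin_form_scale] l2[THEN lin_form_scale]
    have h: "hcomp H p (u + v) = hcomp H p u + hcomp H p v"
      "hcomp H p (sc H k u) = sc H k (hcomp H p u)" for p u v k
      using hcomp_linear[OF S, of p] by (auto simp: Vector_Spaces.linear_iff)
    have m: "sc H k u * v = sc H k (u * v)" "u * sc H k v = sc H k (u * v)" for k u v
    proof -
      have ax: "\<forall>k a b. sc H k (a * b) = sc H k a * b \<and> sc H k (a * b) = a * sc H k b"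
        using H unfolding superalgebra_def by blast
      show "sc H k u * v = sc H k (u * v)" using ax by simp
      show "u * sc H k v = sc H k (u * v)" by (rule ax[rule_format, THEN conjunct2, symmetric])
    qed
    define G where "G = (\<lambda>a b c d.
       \<Sum>p\<in>UNIV. \<Sum>q\<in>UNIV. ksign p q * \<beta> (a * hcomp H q c) (hcomp H p b * d))"
    have B1: "bilin_form H (G a b)" for a b
      unfolding bilin_form_def G_def
      by (intro conjI allI lin_formI V)
        (simp_all add: UNIV_bool h m lin algebra_simps)
    have B2: "bilin_form H (\<lambda>a b. G a b c d)"
      unfolding bilin_form_def G_def
      by (intro conjI allI lin_formI V)
        (simp_all add: UNIV_bool h m lin algebra_simps)
    have z: "\<beta> 0 v = 0" "\<beta> u 0 = 0" for u v
      using lin_form_zero[OF l1] lin_form_zero[OF l2] by simp_all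
    have "tmult H (tensor H a b) (tensor H c d) \<beta> = G a b c d"
    proof -
      have "tmult H (tensor H a b) (tensor H c d) \<beta> =
          tensor H a b (\<lambda>a b. tensor H c d (\<lambda>c d. G a b c d))"
        using True by (simp add: tmult_def G_def)
      then show ?thesis using B1 B2 by (simp add: tensor_def)
    qed
    also have "\<dots> = ksign p q * \<beta> (a * c) (b * d)"
      unfolding G_def by (simp add: UNIV_bool hcomp_hom[OF S b] hcomp_hom[OF S c] z)
    finally show ?thesis
      using True by (simp add: tensor_def fscale_def)
  qed
qed

lemma tensor_sub_mono: "U \<subseteq> U' \<Longrightarrow> W \<subseteq> W' \<Longrightarrow> tensor_sub H U W \<subseteq> tensor_sub H U' W'"
proof -
  interpret vector_space fscale by (rule vector_space_fscale)
  show "U \<subseteq> U' \<Longrightarrow> W \<subseteq> W' \<Longrightarrow> tensor_sub H U W \<subseteq> tensor_sub H U' W'"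
    unfolding tensor_sub_def by (rule span_mono) blast
qed

lemma subsupercoalgebra_sum:
  assumes H: "supercoalgebra H"
    and D: "subsupercoalgebra H D" "fin_dim H D" and E: "subsupercoalgebra H E" "fin_dim H E"
  shows "\<exists>F. subsupercoalgebra H F \<and> fin_dim H F \<and> D \<union> E \<subseteq> F"
proof -
  have S: "superspace H" using H by (simp add: supercoalgebra_def)
  interpret vector_space "sc H" using S by (simp add: superspace_def)
  interpret F: vector_space fscale by (rule vector_space_fscale)
  have h: "hcomp H p (u + v) = hcomp H p u + hcomp H p v" for p u v
    using hcomp_linear[OF S, of p] by (auto simp: Vector_Spaces.linear_iff)
  have cm: "comult H (u + v) = comult H u + comult H v" for u v
    using H by (auto simp: supercoalgebra_def Vector_Spaces.linear_iff)
  have sD: "subspace D" and sE: "subspace E" using D E by (auto simp: subsupercoalgebra_def)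
  define F where "F = {u + v | u v. u \<in> D \<and> v \<in> E}"
  have sub: "D \<subseteq> F" "E \<subseteq> F"
    unfolding F_def using subspace_0[OF sD] subspace_0[OF sE] by force+
  obtain B C where BC: "finite B" "finite C" "D = span B" "E = span C"
    using D E by (auto simp: fin_dim_def)
  have FBC: "F = span (B \<union> C)" unfolding F_def BC span_Un by blast
  have "subsupercoalgebra H F"
    unfolding subsupercoalgebra_def
  proof (intro conjI allI ballI)
    show "subspace F" unfolding FBC by (rule subspace_span)
  next
    fix p d assume "d \<in> F"
    then obtain u v where "d = u + v" "u \<in> D" "v \<in> E" unfolding F_def by blast
    moreover have "hcomp H p u \<in> D" "hcomp H p v \<in> E"
      using D E calculation by (auto simp: subsupercoalgebra_def)
    ultimately show "hcomp H p d \<in> F" unfolding F_def using h by blast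
  next
    fix d assume "d \<in> F"
    then obtain u v where uv: "d = u + v" "u \<in> D" "v \<in> E" unfolding F_def by blast
    have "comult H u \<in> tensor_sub H F F" "comult H v \<in> tensor_sub H F F"
      using D E uv tensor_sub_mono[OF sub(1) sub(1)] tensor_sub_mono[OF sub(2) sub(2)]
      unfolding subsupercoalgebra_def by blast+
    then show "comult H d \<in> tensor_sub H F F"
      unfolding uv cm tensor_sub_def by (rule F.span_add)
  qed
  moreover have "fin_dim H F" unfolding fin_dim_def FBC using BC by blast
  ultimately show ?thesis using sub by blast
qed

lemma istopology_dual_open:
  assumes H: "supercoalgebra H"
  shows "istopology (dual_open H)"
  unfolding istopology_def
proof (intro conjI allI impI)
  fix U W assume U: "dual_open H U" and W: "dual_open H W"
  show "dual_open H (U \<inter> W)"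
    unfolding dual_open_def
  proof (intro conjI ballI)
    show "U \<inter> W \<subseteq> dual H" using U by (auto simp: dual_open_def)
  next
    fix \<phi> assume "\<phi> \<in> U \<inter> W"
    then have \<phi>: "\<phi> \<in> U" "\<phi> \<in> W" by auto
    obtain D where
      D: "subsupercoalgebra H D" "fin_dim H D" "\<forall>\<psi>\<in>perp H D. \<phi> + \<psi> \<in> U"
      using U \<phi>(1) unfolding dual_open_def by blast
    obtain E where
      E: "subsupercoalgebra H E" "fin_dim H E" "\<forall>\<psi>\<in>perp H E. \<phi> + \<psi> \<in> W"
      using W \<phi>(2) unfolding dual_open_def by blast
    obtain F where F: "subsupercoalgebra H F" "fin_dim H F" "D \<union> E \<subseteq> F"
      using subsupercoalgebra_sum[OF H D(1,2) E(1,2)] by blast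
    moreover have "perp H F \<subseteq> perp H D" "perp H F \<subseteq> perp H E"
      using F(3) by (auto simp: perp_def)
    ultimately show
      "\<exists>D. subsupercoalgebra H D \<and> fin_dim H D \<and> (\<forall>\<psi>\<in>perp H D. \<phi> + \<psi> \<in> U \<inter> W)"
      using D(3) E(3) by blast
  qed
next
  fix \<K> assume "\<forall>U\<in>\<K>. dual_open H U"
  then show "dual_open H (\<Union>\<K>)" unfolding dual_open_def by (meson Sup_least UnionE UnionI)
qed

lemma openin_dual_topology:
  "supercoalgebra H \<Longrightarrow> openin (dual_topology H) = dual_open H"
  unfolding dual_topology_def by (rule topology_inverse'[OF istopology_dual_open])

end

theory Submission
  imports Defs "Jordan_Normal_Form.Determinant"
begin

text \<open>
  An open superideal contains \<open>Dist(G) \<inter> D\<^sup>\<bottom>\<close> for a finite-dimensional subsupercoalgebra \<open>D\<close>, so one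
  needs that \<open>K[G]\<close> is the sum of the \<open>C\<^bsub>l,s\<^esub>\<close>, i.e. is generated by the entries of \<open>X = (x\<^sub>i\<^sub>j)\<close> and of
  \<open>Y = X\<^sup>-\<^sup>1 = (s\<^sub>G(x\<^sub>i\<^sub>j))\<close>. For the diagonal blocks, \<open>Y\<^sub>0\<^sub>0 X\<^sub>0\<^sub>0 = 1 - Y\<^sub>0\<^sub>1 X\<^sub>1\<^sub>0\<close>, and the entries of
  \<open>Y\<^sub>0\<^sub>1 X\<^sub>1\<^sub>0\<close> are sums of products of two odd elements, which are nilpotent. Hence
  \<open>det(Y\<^sub>0\<^sub>0) det(X\<^sub>0\<^sub>0)\<close> is \<open>1\<close> plus a nilpotent element, and \<open>det(X\<^sub>0\<^sub>0)\<^sup>-\<^sup>1\<close> lies in the generated algebra;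
  likewise for the other block.

  Conversely, every finite-dimensional subspace of a supercoalgebra, in particular a finite sum of
  \<open>C\<^bsub>l,s\<^esub>\<close>, lies in a finite-dimensional subsupercoalgebra \<open>D\<close>, and then \<open>I + D\<^sup>\<bottom>\<close> is open and meets
  \<open>Dist(G)\<close> in \<open>I\<close>.
\<close>

section \<open>Finite-dimensional subsupercoalgebras\<close>

lemma bilin_formD:
  assumes "bilin_form H \<beta>"
  shows "lin_form H (\<beta> a)" "lin_form H (\<lambda>a. \<beta> a b)"
  using assms by (auto simp: bilin_form_def)

lemma lin_form_sum: "lin_form H f \<Longrightarrow> f (sum g S) = (\<Sum>i\<in>S. f (g i))"
  by (induction S rule: infinite_finite_induct) (simp_all add: lin_form_zero lin_form_add)

lemma lin_form_cmult:
  assumes V: "vector_space (sc H)" and f: "lin_form H f"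
  shows "lin_form H (\<lambda>a. k * f a)" "lin_form H (\<lambda>a. f a * k)"
  by (rule lin_formI[OF V]; simp add: lin_form_add[OF f] lin_form_scale[OF f] algebra_simps)+

lemma lin_form_plus:
  assumes V: "vector_space (sc H)" and "lin_form H f" "lin_form H g"
  shows "lin_form H (\<lambda>a. f a + g a)"
  by (rule lin_formI[OF V]; simp add: lin_form_add[OF assms(2)] lin_form_scale[OF assms(2)]
      lin_form_add[OF assms(3)] lin_form_scale[OF assms(3)] algebra_simps)

lemma bilin_form_prod:
  assumes V: "vector_space (sc H)" and f: "lin_form H f" and g: "lin_form H g"
  shows "bilin_form H (\<lambda>a b. f a * g b)"
  unfolding bilin_form_def by (intro conjI allI lin_form_cmult[OF V] f g)

text \<open>A maximal independent subset \<open>B\<close> of \<open>S\<close> stays independent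
  after adjoining \<open>v\<close>, so the values \<open>1\<close> at \<open>v\<close> and
  \<open>0\<close> on \<open>B\<close> extend linearly. This yields dual families without any
  dimension hypothesis.\<close>

lemma separating_form:
  fixes H :: "('k::field, 'a::ab_group_add, 'z) superdata_scheme"
  assumes V: "vector_space (sc H)" and v: "v \<notin> module.span (sc H) S"
  obtains f where "lin_form H f" "f v = 1" "\<And>s. s \<in> S \<Longrightarrow> f s = 0"
proof -
  interpret K: vector_space "(*) :: 'k \<Rightarrow> 'k \<Rightarrow> 'k" by unfold_locales (auto simp: algebra_simps)
  interpret vector_space_pair "sc H" "(*) :: 'k \<Rightarrow> 'k \<Rightarrow> 'k"
    using V by (intro vector_space_pair.intro K.vector_space_axioms)
  obtain B where B: "B \<subseteq> S" "vs1.independent B" "S \<subseteq> vs1.span B"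
    using vs1.maximal_independent_subset by blast
  have vB: "v \<notin> vs1.span B" using v B(1) vs1.span_mono by blast
  then have ind: "vs1.independent (insert v B)" using B(2) by (rule vs1.independent_insertI)
  obtain f where f: "Vector_Spaces.linear (sc H) (*) f"
    "\<forall>b\<in>insert v B. f b = (if b = v then 1 else 0)"
    using linear_independent_extend[OF ind, of "\<lambda>b. if b = v then 1 else 0"] by blast
  have l: "lin_form H f" using f(1) by (simp add: lin_form_def)
  have zB: "f b = 0" if "b \<in> B" for b using f(2) that vB vs1.span_base by auto
  have "f s = 0" if "s \<in> vs1.span B" for s
    using that
  proof (induction rule: vs1.span_induct_alt)
    case base then show ?case by (rule lin_form_zero[OF l])
  next
    case (step c b y) then show ?case by (simp add: lin_form_add[OF l] lin_form_scale[OF l] zB)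
  qed
  moreover have "f v = 1" using f(2) by simp
  ultimately show ?thesis using that[OF l] B(3) by blast
qed

locale supercoalg =
  fixes H :: "('k::field, 'a::ab_group_add, 'z) coalg_data_scheme"
  assumes H: "supercoalgebra H"
begin

lemma S: "superspace H" using H by (simp add: supercoalgebra_def)

sublocale vector_space "sc H" using S by (simp add: superspace_def)
sublocale FF: vector_space "fscale :: 'k \<Rightarrow> (('a \<Rightarrow> 'a \<Rightarrow> 'k) \<Rightarrow> 'k) \<Rightarrow> (('a \<Rightarrow> 'a \<Rightarrow> 'k) \<Rightarrow> 'k)"
  by (rule vector_space_fscale)

lemma comult_linear: "Vector_Spaces.linear (sc H) fscale (comult H)"
  and comult_gr: "c \<in> gr H p \<Longrightarrow> comult H c \<in> tensor_gr H p"
  and coassoc: "trilin_form H \<gamma> \<Longrightarrow>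
        comult H c (\<lambda>a b. comult H a (\<lambda>a' a''. \<gamma> a' a'' b)) =
        comult H c (\<lambda>a b. comult H b (\<lambda>b' b''. \<gamma> a b' b''))"
  and counit_left: "sweedler H c ts \<Longrightarrow> (\<Sum>(a, b)\<leftarrow>ts. sc H (counit H a) b) = c"
  and counit_right: "sweedler H c ts \<Longrightarrow> (\<Sum>(a, b)\<leftarrow>ts. sc H (counit H b) a) = c"
  using H unfolding supercoalgebra_def by blast+

lemma comult_add: "comult H (a + b) = comult H a + comult H b"
  and comult_scale: "comult H (sc H k a) = fscale k (comult H a)"
  using comult_linear by (simp_all add: Vector_Spaces.linear_iff)

lemma hcomp_add: "hcomp H p (a + b) = hcomp H p a + hcomp H p b"
  and hcomp_scale: "hcomp H p (sc H k a) = sc H k (hcomp H p a)"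
  using hcomp_linear[OF S, of p] by (simp_all add: Vector_Spaces.linear_iff)

lemma hcomp_split: "hcomp H False a + hcomp H True a = a"
proof -
  have "hcomp H True a = a - hcomp H False a"
    by (rule hcomp_unique[OF S]) (use hcomp_mem[OF S, where p = False and a = a] in simp_all)
  then show ?thesis by simp
qed

lemma tensor_scale: "fscale k (tensor H a b) = tensor H (sc H k a) b"
  by (auto simp: fscale_def tensor_def fun_eq_iff lin_form_scale[OF bilin_formD(2)])

lemma tensor_add_left: "tensor H (a + a') b = tensor H a b + tensor H a' b"
  by (auto simp: tensor_def fun_eq_iff lin_form_add[OF bilin_formD(2)])

lemma tensor_add_right: "tensor H a (b + b') = tensor H a b + tensor H a b'"
  by (auto simp: tensor_def fun_eq_iff lin_form_add[OF bilin_formD(1)])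

lemma tensor_zero: "tensor H 0 b = 0" "tensor H a 0 = 0"
  using tensor_add_left[of 0 0 b] tensor_add_right[of a 0 0] by simp_all

section \<open>The coproduct as a finite sum of tensors\<close>

lemma tensor_gr_sq: "tensor_gr H p \<subseteq> tensor_sq H"
  unfolding tensor_gr_def tensor_sub_def by (rule FF.span_mono) blast

text \<open>The axioms place the coproduct in the tensor square for homogeneous elements only; a
  general element is split into its even and odd components.\<close>

lemma comult_sq: "comult H c \<in> tensor_sq H"
proof -
  have "comult H (hcomp H p c) \<in> tensor_sq H" for p
    using comult_gr hcomp_mem(1)[OF S] tensor_gr_sq by blast
  then have "comult H (hcomp H False c) + comult H (hcomp H True c) \<in> tensor_sq H"
    unfolding tensor_sub_def by (intro FF.span_add)
  then show ?thesis by (simp add: hcomp_split flip: comult_add)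
qed

text \<open>Indexing by a finite set of naturals, rather than by a list as in
  \<open>sweedler\<close>, makes it easy to drop one term and to compare lengths by
  \<open>card\<close>.\<close>

definition presents :: "'a \<Rightarrow> nat set \<Rightarrow> (nat \<Rightarrow> 'a) \<Rightarrow> (nat \<Rightarrow> 'a) \<Rightarrow> bool" where
  "presents c J a u \<longleftrightarrow> finite J \<and> comult H c = (\<Sum>i\<in>J. tensor H (a i) (u i))"

lemma presents_ex: "\<exists>J a u. presents c J a u"
proof -
  \<comment> \<open>The claim is generalised from the coproduct of \<open>c\<close> to an arbitrary
    tensor \<open>t\<close>, so that induction over the span applies.\<close>
  define Q where "Q t J a u \<longleftrightarrow> finite J \<and> t = (\<Sum>i\<in>J. tensor H (a i) (u i))"
    for t and J :: "nat set" and a u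
  have "\<exists>J a u. Q t J a u" if "t \<in> tensor_sq H" for t
    using that unfolding tensor_sub_def
  proof (induction rule: FF.span_induct_alt)
    case base
    have "Q 0 {} (\<lambda>i. 0) (\<lambda>i. 0)" by (simp add: Q_def)
    then show ?case by blast
  next
    case (step k s t)
    then obtain J a u where "Q t J a u" by blast
    then have J: "finite J" "t = (\<Sum>i\<in>J. tensor H (a i) (u i))" by (simp_all add: Q_def)
    obtain b v where s: "s = tensor H b v" using step by blast
    \<comment> \<open>The new term gets a fresh index, and the scalar \<open>k\<close> is absorbed
      into its left factor.\<close>
    obtain j where j: "j \<notin> J" using ex_new_if_finite[OF infinite_UNIV_nat J(1)] by blast
    have "(\<Sum>i\<in>insert j J. tensor H ((a(j := sc H k b)) i) ((u(j := v)) i)) =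
        fscale k s + (\<Sum>i\<in>J. tensor H ((a(j := sc H k b)) i) ((u(j := v)) i))"
      using J(1) j by (simp add: s tensor_scale)
    also have "(\<Sum>i\<in>J. tensor H ((a(j := sc H k b)) i) ((u(j := v)) i)) = t"
      unfolding J(2) by (rule sum.cong) (use j in auto)
    finally have "Q (fscale k s + t) (insert j J) (a(j := sc H k b)) (u(j := v))"
      using J(1) by (simp only: Q_def finite_insert)
    then show ?case by blast
  qed
  from this[OF comult_sq] show ?thesis by (simp add: presents_def Q_def)
qed

lemma sum_fun_apply: "(\<Sum>i\<in>A. f i) x = (\<Sum>i\<in>A. f i x)"
  by (induction A rule: infinite_finite_induct) simp_all

lemma presents_eval:
  assumes "presents c J a u"
  shows "comult H c \<beta> = (if bilin_form H \<beta> then \<Sum>i\<in>J. \<beta> (a i) (u i) else 0)"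
proof -
  have "comult H c \<beta> = (\<Sum>i\<in>J. tensor H (a i) (u i) \<beta>)"
    using assms by (simp add: presents_def sum_fun_apply)
  then show ?thesis by (simp add: tensor_def)
qed

text \<open>With the default value \<open>0\<close> off bilinear forms, an identity between tensors
  has to be checked at bilinear arguments only.\<close>

lemma comult_not_bilin: "\<not> bilin_form H \<beta> \<Longrightarrow> comult H c \<beta> = 0"
  using presents_ex[of c] presents_eval by fastforce

lemma presents_sweedler:
  assumes "presents c J a u"
  shows "sweedler H c (map (\<lambda>i. (a i, u i)) (sorted_list_of_set J))"
  using assms by (simp add: presents_def sweedler_def comp_def sum_list_distinct_conv_sum_set)

lemma presents_counit:
  assumes "presents c J a u"
  shows "(\<Sum>i\<in>J. sc H (counit H (a i)) (u i)) = c" "(\<Sum>i\<in>J. sc H (counit H (u i)) (a i)) = c"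
  using counit_left[OF presents_sweedler[OF assms]] counit_right[OF presents_sweedler[OF assms]] assms
  by (simp_all add: presents_def comp_def sum_list_distinct_conv_sum_set)

text \<open>Left and right legs of a presentation with the least number of terms are linearly independent,
  since a dependency would allow to drop a term.\<close>

lemma presents_independent:
  obtains J a u where "presents c J a u"
    "\<And>k. k \<in> J \<Longrightarrow> a k \<notin> span (a ` (J - {k}))" "\<And>k. k \<in> J \<Longrightarrow> u k \<notin> span (u ` (J - {k}))"
proof -
  define P where "P n \<longleftrightarrow> (\<exists>J a u. presents c J a u \<and> card J = n)" for n
  have "\<exists>n. P n" unfolding P_def using presents_ex by blast
  then have least: "P (LEAST n. P n)" by (rule LeastI_ex)
  obtain J a u where J: "presents c J a u" "card J = (LEAST n. P n)"
    using least unfolding P_def by blast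
  have fin: "finite J" and \<Delta>: "comult H c = (\<Sum>i\<in>J. tensor H (a i) (u i))"
    using J(1) by (auto simp: presents_def)
  have minimal: False if "k \<in> J" "presents c (J - {k}) a' u'" for k a' u'
  proof -
    have "P (card (J - {k}))" unfolding P_def using that by blast
    then have "card J \<le> card (J - {k})" unfolding J(2) by (rule Least_le)
    then show False using card_Diff1_less[OF fin that(1)] by simp
  qed
  have combination: "\<exists>l. v k = (\<Sum>i\<in>J - {k}. sc H (l i) (v i))"
    if "v k \<in> span (v ` (J - {k}))" for v :: "nat \<Rightarrow> 'a" and k
    using that
  proof (induction rule: span_induct_alt)
    case base
    show ?case by (rule exI[of _ "\<lambda>i. 0"]) simp
  next
    case (step r w y)
    from step(2) obtain l where l: "y = (\<Sum>i\<in>J - {k}. sc H (l i) (v i))" by (elim exE) (rule that)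
    from step(1) obtain i where i: "i \<in> J - {k}" "w = v i" by blast
    have "sc H r w + y = (\<Sum>j\<in>J - {k}. sc H ((if j = i then r else 0) + l j) (v j))"
      using l i fin by (simp add: scale_left_distrib sum.distrib if_distrib[of "\<lambda>r. sc H r _"] cong: if_cong)
    then show ?case by (rule exI[of _ "\<lambda>j. (if j = i then r else 0) + l j"])
  qed
  have indep_a: "a k \<notin> span (a ` (J - {k}))" if k: "k \<in> J" for k
  proof
    assume "a k \<in> span (a ` (J - {k}))"
    then obtain l where l: "a k = (\<Sum>i\<in>J - {k}. sc H (l i) (a i))" using combination by metis
    \<comment> \<open>The dependency rewrites the \<open>k\<close>-th term as the sum of the tensors
      of \<open>a i\<close> with \<open>sc H (l i) (u k)\<close>, which are absorbed into the right
      legs of the remaining terms.\<close>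
    have "comult H c = (\<Sum>i\<in>J - {k}. tensor H (a i) (u i + sc H (l i) (u k)))"
    proof
      fix \<beta>
      show "comult H c \<beta> = (\<Sum>i\<in>J - {k}. tensor H (a i) (u i + sc H (l i) (u k))) \<beta>"
      proof (cases "bilin_form H \<beta>")
        case True
        note b = bilin_formD[OF True]
        have "\<beta> (a k) (u k) = (\<Sum>i\<in>J - {k}. l i * \<beta> (a i) (u k))"
          unfolding l by (simp add: lin_form_sum[OF b(2)] lin_form_scale[OF b(2)])
        then show ?thesis using True k fin
          by (simp add: presents_eval[OF J(1)] sum_fun_apply tensor_def lin_form_add[OF b(1)]
              lin_form_scale[OF b(1)] sum.distrib sum.remove[of J k])
      qed (simp add: comult_not_bilin sum_fun_apply tensor_def)
    qed
    then have "presents c (J - {k}) a (\<lambda>i. u i + sc H (l i) (u k))"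
      using fin by (simp add: presents_def)
    then show False by (rule minimal[OF k])
  qed
  have indep_u: "u k \<notin> span (u ` (J - {k}))" if k: "k \<in> J" for k
  proof
    assume "u k \<in> span (u ` (J - {k}))"
    then obtain l where l: "u k = (\<Sum>i\<in>J - {k}. sc H (l i) (u i))" using combination by metis
    have "comult H c = (\<Sum>i\<in>J - {k}. tensor H (a i + sc H (l i) (a k)) (u i))"
    proof
      fix \<beta>
      show "comult H c \<beta> = (\<Sum>i\<in>J - {k}. tensor H (a i + sc H (l i) (a k)) (u i)) \<beta>"
      proof (cases "bilin_form H \<beta>")
        case True
        note b = bilin_formD[OF True]
        have "\<beta> (a k) (u k) = (\<Sum>i\<in>J - {k}. l i * \<beta> (a k) (u i))"
          unfolding l by (simp add: lin_form_sum[OF b(1)] lin_form_scale[OF b(1)])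
        then show ?thesis using True k fin
          by (simp add: presents_eval[OF J(1)] sum_fun_apply tensor_def lin_form_add[OF b(2)]
              lin_form_scale[OF b(2)] sum.distrib sum.remove[of J k])
      qed (simp add: comult_not_bilin sum_fun_apply tensor_def)
    qed
    then have "presents c (J - {k}) (\<lambda>i. a i + sc H (l i) (a k)) u"
      using fin by (simp add: presents_def)
    then show False by (rule minimal[OF k])
  qed
  show ?thesis using that J(1) indep_a indep_u by blast
qed

section \<open>Dual families, slices and coassociativity\<close>

lemma dual_family:
  assumes "\<And>k. k \<in> J \<Longrightarrow> a k \<notin> span (a ` (J - {k}))"
  obtains f where "\<And>k. k \<in> J \<Longrightarrow> lin_form H (f k)"
    "\<And>k i. k \<in> J \<Longrightarrow> i \<in> J \<Longrightarrow> f k (a i) = (if i = k then 1 else 0)"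
proof -
  have "\<exists>f. lin_form H f \<and> (\<forall>i\<in>J. f (a i) = (if i = k then 1 else 0))" if "k \<in> J" for k
    using separating_form[OF vector_space_axioms assms[OF that]]
    by (metis (no_types, lifting) DiffI imageI singletonD)
  then show ?thesis using that by metis
qed

text \<open>The witness is the slice of the coproduct of \<open>v\<close> by \<open>f\<close> in the
  left leg. It is characterised through its values under linear forms, so that no presentation of
  the coproduct appears in later computations.\<close>

lemma slice_ex:
  assumes f: "lin_form H f"
  shows "\<exists>e. \<forall>\<phi>. lin_form H \<phi> \<longrightarrow> comult H v (\<lambda>a b. f a * \<phi> b) = \<phi> e"
proof -
  obtain J a u where J: "presents v J a u" using presents_ex by blast
  show ?thesis
    by (rule exI[of _ "\<Sum>i\<in>J. sc H (f (a i)) (u i)"])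
      (simp add: presents_eval[OF J] bilin_form_prod[OF vector_space_axioms f] lin_form_sum lin_form_scale)
qed

lemma comult_form_add:
  assumes "bilin_form H \<beta>" "bilin_form H \<beta>'"
  shows "comult H c (\<lambda>a b. \<beta> a b + \<beta>' a b) = comult H c \<beta> + comult H c \<beta>'"
proof -
  obtain J a u where J: "presents c J a u" using presents_ex by blast
  have "bilin_form H (\<lambda>a b. \<beta> a b + \<beta>' a b)"
    unfolding bilin_form_def
    by (intro conjI allI lin_form_plus vector_space_axioms bilin_formD assms)
  then show ?thesis using assms by (simp add: presents_eval[OF J] sum.distrib)
qed

lemma comult_form_scale:
  assumes "bilin_form H \<beta>"
  shows "comult H c (\<lambda>a b. k * \<beta> a b) = k * comult H c \<beta>"
proof -
  obtain J a u where J: "presents c J a u" using presents_ex by blast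
  have "bilin_form H (\<lambda>a b. k * \<beta> a b)"
    unfolding bilin_form_def
    by (intro conjI allI lin_form_cmult vector_space_axioms bilin_formD assms)
  then show ?thesis using assms by (simp add: presents_eval[OF J] sum_distrib_left)
qed

lemma trilin_formI:
  assumes "\<And>a b. lin_form H (\<lambda>c. \<gamma> a b c)" "\<And>a c. lin_form H (\<lambda>b. \<gamma> a b c)" "\<And>b c. lin_form H (\<lambda>a. \<gamma> a b c)"
  shows "trilin_form H \<gamma>"
  using assms by (simp add: trilin_form_def bilin_form_def)

text \<open>Coassociativity evaluates the coproduct at forms that themselves contain a coproduct.
  Such an outer evaluation can be expanded over a presentation once the inner expression is known to
  be bilinear.\<close>

lemma bilin_comult_left:
  assumes "\<And>a b. lin_form H (\<lambda>c. \<gamma> a b c)" "\<And>a c. lin_form H (\<lambda>b. \<gamma> a b c)" "\<And>b c. lin_form H (\<lambda>a. \<gamma> a b c)"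
  shows "bilin_form H (\<lambda>a b. comult H a (\<lambda>a' a''. \<gamma> a' a'' b))"
    and "bilin_form H (\<lambda>a b. comult H b (\<lambda>b' b''. \<gamma> a b' b''))"
proof -
  have eq: "\<gamma> (a + a') = (\<lambda>b c. \<gamma> a b c + \<gamma> a' b c)" "\<gamma> (sc H k a) = (\<lambda>b c. k * \<gamma> a b c)" for a a' k
    by (simp_all add: fun_eq_iff lin_form_add[OF assms(3)] lin_form_scale[OF assms(3)])
  have b: "bilin_form H (\<lambda>a b. \<gamma> a b c)" "bilin_form H (\<lambda>b c. \<gamma> a b c)" for a c
    using assms by (simp_all add: bilin_form_def)
  show "bilin_form H (\<lambda>a b. comult H a (\<lambda>a' a''. \<gamma> a' a'' b))"
    unfolding bilin_form_def
    by (intro conjI allI lin_formI[OF vector_space_axioms])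
      (simp_all add: comult_add comult_scale fscale_def lin_form_add[OF assms(1)] lin_form_scale[OF assms(1)]
        comult_form_add comult_form_scale b)
  show "bilin_form H (\<lambda>a b. comult H b (\<lambda>b' b''. \<gamma> a b' b''))"
    unfolding bilin_form_def
    by (intro conjI allI lin_formI[OF vector_space_axioms])
      (simp_all add: comult_add comult_scale fscale_def eq
        comult_form_add comult_form_scale b)
qed

text \<open>If \<open>\<Delta>(c) = \<Sum>\<^sub>i a\<^sub>i \<otimes> u\<^sub>i\<close> with independent \<open>a\<^sub>i\<close> and independent \<open>u\<^sub>i\<close>, and \<open>f\<^sub>i\<close> is dual to \<open>a\<^sub>i\<close>, then
  coassociativity makes \<open>e\<^sub>i\<^sub>j = (f\<^sub>i \<otimes> id) \<Delta>(a\<^sub>j)\<close> a matrix coalgebra: \<open>\<Delta>(u\<^sub>i) = \<Sum>\<^sub>j e\<^sub>i\<^sub>j \<otimes> u\<^sub>j\<close> and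
  \<open>\<Delta>(e\<^sub>i\<^sub>k) = \<Sum>\<^sub>j e\<^sub>i\<^sub>j \<otimes> e\<^sub>j\<^sub>k\<close>.\<close>

lemma finite_subcoalgebra:
  "\<exists>B. finite B \<and> c \<in> span B \<and> (\<forall>b\<in>B. comult H b \<in> tensor_sub H B B)"
proof -
  obtain J a u where J: "presents c J a u"
    and indep: "\<And>k. k \<in> J \<Longrightarrow> a k \<notin> span (a ` (J - {k}))" "\<And>k. k \<in> J \<Longrightarrow> u k \<notin> span (u ` (J - {k}))"
    using presents_independent[of c] by metis
  obtain f where f: "\<And>k. k \<in> J \<Longrightarrow> lin_form H (f k)"
    "\<And>k i. k \<in> J \<Longrightarrow> i \<in> J \<Longrightarrow> f k (a i) = (if i = k then 1 else 0)"
    using dual_family[of J a] indep(1) by metis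
  obtain g where g: "\<And>k. k \<in> J \<Longrightarrow> lin_form H (g k)"
    "\<And>k i. k \<in> J \<Longrightarrow> i \<in> J \<Longrightarrow> g k (u i) = (if i = k then 1 else 0)"
    using dual_family[of J u] indep(2) by metis
  \<comment> \<open>A chosen slice of the coproduct of \<open>a j\<close> by
    \<open>f i\<close>.\<close>
  define e where "e i j = (SOME e. \<forall>\<phi>. lin_form H \<phi> \<longrightarrow>
      comult H (a j) (\<lambda>b b'. f i b * \<phi> b') = \<phi> e)" for i j
  have e: "comult H (a j) (\<lambda>b b'. f i b * \<phi> b') = \<phi> (e i j)"
    if "i \<in> J" "lin_form H \<phi>" for i j \<phi>
    using someI_ex[OF slice_ex[OF f(1)[OF that(1)], of "a j"]] that(2) unfolding e_def by blast
  have fin: "finite J" using J by (simp add: presents_def)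
  have \<Delta>u: "presents (u i) J (e i) u" if i: "i \<in> J" for i
    unfolding presents_def
  proof (intro conjI ext fin)
    fix \<beta>
    show "comult H (u i) \<beta> = (\<Sum>j\<in>J. tensor H (e i j) (u j)) \<beta>"
    proof (cases "bilin_form H \<beta>")
      case True
      note b = bilin_formD[OF True]
      \<comment> \<open>The factor \<open>f i\<close> in the first variable selects the single right
        leg \<open>u i\<close> from the presentation of \<open>c\<close>. After coassociativity it
        acts on the coproducts of the left legs and produces the slices
        \<open>e i j\<close>.\<close>
      define \<gamma> where "\<gamma> a b c = f i a * \<beta> b c" for a b c
      have \<gamma>: "lin_form H (\<gamma> a b)" "lin_form H (\<lambda>b. \<gamma> a b c)" "lin_form H (\<lambda>a. \<gamma> a b c)" for a b c
        unfolding \<gamma>_def by (intro lin_form_cmult[OF vector_space_axioms] b f(1)[OF i])+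
      have "comult H (u i) \<beta> = (\<Sum>j\<in>J. (if j = i then 1 else 0) * comult H (u j) \<beta>)"
        using fin i by (simp add: if_distrib[of "\<lambda>x. x * _"] cong: if_cong)
      also have "\<dots> = (\<Sum>j\<in>J. comult H (u j) (\<lambda>b' b''. \<gamma> (a j) b' b''))"
        unfolding \<gamma>_def by (rule sum.cong) (simp_all add: f(2) i comult_form_scale[OF True])
      also have "\<dots> = comult H c (\<lambda>a b. comult H b (\<lambda>b' b''. \<gamma> a b' b''))"
        using bilin_comult_left(2)[OF \<gamma>] by (simp add: presents_eval[OF J])
      also have "\<dots> = comult H c (\<lambda>a b. comult H a (\<lambda>a' a''. \<gamma> a' a'' b))"
        by (rule coassoc[OF trilin_formI[OF \<gamma>], symmetric])
      also have "\<dots> = (\<Sum>j\<in>J. comult H (a j) (\<lambda>a' a''. \<gamma> a' a'' (u j)))"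
        using bilin_comult_left(1)[OF \<gamma>] by (simp add: presents_eval[OF J])
      also have "\<dots> = (\<Sum>j\<in>J. \<beta> (e i j) (u j))"
        unfolding \<gamma>_def by (rule sum.cong) (simp_all add: e[OF i b(2)])
      finally show ?thesis using True by (simp add: sum_fun_apply tensor_def)
    qed (simp add: comult_not_bilin sum_fun_apply tensor_def)
  qed
  have \<Delta>e: "comult H (e i k) = (\<Sum>j\<in>J. tensor H (e i j) (e j k))" if i: "i \<in> J" and k: "k \<in> J" for i k
  proof
    fix \<beta>
    show "comult H (e i k) \<beta> = (\<Sum>j\<in>J. tensor H (e i j) (e j k)) \<beta>"
    proof (cases "bilin_form H \<beta>")
      case True
      note b = bilin_formD[OF True]
      \<comment> \<open>Now coassociativity is applied to \<open>u i\<close>, and \<open>g k\<close>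
        in the last variable selects the coefficient of \<open>u k\<close>.\<close>
      define \<gamma> where "\<gamma> a b c = g k c * \<beta> a b" for a b c
      have \<gamma>: "lin_form H (\<gamma> a b)" "lin_form H (\<lambda>b. \<gamma> a b c)" "lin_form H (\<lambda>a. \<gamma> a b c)" for a b c
        unfolding \<gamma>_def by (intro lin_form_cmult[OF vector_space_axioms] b g(1)[OF k])+
      have bl: "bilin_form H (\<gamma> a)" for a using \<gamma> by (simp add: bilin_form_def)
      have "comult H (e i k) \<beta> = (\<Sum>j\<in>J. (if j = k then 1 else 0) * comult H (e i j) \<beta>)"
        using fin k by (simp add: if_distrib[of "\<lambda>x. x * _"] cong: if_cong)
      also have "\<dots> = (\<Sum>j\<in>J. comult H (e i j) (\<lambda>a' a''. \<gamma> a' a'' (u j)))"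
        unfolding \<gamma>_def by (rule sum.cong) (simp_all add: g(2) k comult_form_scale[OF True])
      also have "\<dots> = comult H (u i) (\<lambda>a b. comult H a (\<lambda>a' a''. \<gamma> a' a'' b))"
        using bilin_comult_left(1)[OF \<gamma>] by (simp add: presents_eval[OF \<Delta>u[OF i]])
      also have "\<dots> = comult H (u i) (\<lambda>a b. comult H b (\<lambda>b' b''. \<gamma> a b' b''))"
        by (rule coassoc[OF trilin_formI[OF \<gamma>]])
      also have "\<dots> = (\<Sum>j\<in>J. comult H (u j) (\<lambda>b' b''. \<gamma> (e i j) b' b''))"
        using bilin_comult_left(2)[OF \<gamma>] by (simp add: presents_eval[OF \<Delta>u[OF i]])
      also have "\<dots> = (\<Sum>j\<in>J. \<Sum>l\<in>J. \<gamma> (e i j) (e j l) (u l))"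
        by (rule sum.cong) (simp_all add: presents_eval[OF \<Delta>u] bl)
      also have "\<dots> = (\<Sum>j\<in>J. \<beta> (e i j) (e j k))"
        unfolding \<gamma>_def using fin k
        by (intro sum.cong) (simp_all add: g(2) if_distrib[of "\<lambda>x. x * _"] cong: if_cong)
      finally show ?thesis using True by (simp add: sum_fun_apply tensor_def)
    qed (simp add: comult_not_bilin sum_fun_apply tensor_def)
  qed
  define B where "B = (\<lambda>(i, j). e i j) ` (J \<times> J)"
  have eB: "e i j \<in> B" if "i \<in> J" "j \<in> J" for i j using that by (auto simp: B_def)
  \<comment> \<open>The counit applied to the right legs of the coproduct of \<open>u i\<close>
    writes it as a combination of the \<open>e i j\<close>; applied to the left legs of the
    presentation of \<open>c\<close>, it then writes \<open>c\<close> as a combination of the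
    \<open>u i\<close>.\<close>
  have "u i \<in> span B" if i: "i \<in> J" for i
  proof -
    have "(\<Sum>j\<in>J. sc H (counit H (u j)) (e i j)) \<in> span B"
      by (intro span_sum span_scale span_base eB i)
    then show ?thesis by (simp add: presents_counit(2)[OF \<Delta>u[OF i]])
  qed
  then have "(\<Sum>i\<in>J. sc H (counit H (a i)) (u i)) \<in> span B"
    by (intro span_sum span_scale)
  then have "c \<in> span B" by (simp add: presents_counit(1)[OF J])
  moreover have "comult H b \<in> tensor_sub H B B" if "b \<in> B" for b
  proof -
    from that obtain i k where ik: "i \<in> J" "k \<in> J" "b = e i k" by (auto simp: B_def)
    have "(\<Sum>j\<in>J. tensor H (e i j) (e j k)) \<in> tensor_sub H B B"
      unfolding tensor_sub_def by (intro FF.span_sum FF.span_base) (use ik eB in blast)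
    then show ?thesis using ik by (simp add: \<Delta>e)
  qed
  moreover have "finite B" using fin by (simp add: B_def)
  ultimately show ?thesis by blast
qed

section \<open>Parity projections on the tensor square\<close>

definition tensor_hcomp :: "bool \<Rightarrow> (('a \<Rightarrow> 'a \<Rightarrow> 'k) \<Rightarrow> 'k) \<Rightarrow> ('a \<Rightarrow> 'a \<Rightarrow> 'k) \<Rightarrow> 'k" where
  "tensor_hcomp p t = (\<lambda>\<beta>. if bilin_form H \<beta>
     then t (\<lambda>a b. \<Sum>q\<in>UNIV. \<beta> (hcomp H (p \<noteq> q) a) (hcomp H q b)) else 0)"

text \<open>The projection \<open>tensor_hcomp\<close> acts by transposition: it evaluates a tensor
  at the form composed with parity projections. That composed form must be bilinear, as pure tensors
  vanish on all other arguments.\<close>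

lemma bilin_form_hcomp:
  assumes "bilin_form H \<beta>"
  shows "bilin_form H (\<lambda>a b. \<Sum>q\<in>UNIV. \<beta> (hcomp H (p \<noteq> q) a) (hcomp H q b))"
proof -
  note b = bilin_formD[OF assms]
  show ?thesis
    unfolding bilin_form_def
    by (intro conjI allI lin_formI[OF vector_space_axioms])
      (simp_all add: UNIV_bool hcomp_add hcomp_scale b[THEN lin_form_add] b[THEN lin_form_scale]
        algebra_simps)
qed

lemma tensor_hcomp_tensor:
  "tensor_hcomp p (tensor H a b) = (\<Sum>q\<in>UNIV. tensor H (hcomp H (p \<noteq> q) a) (hcomp H q b))"
proof
  fix \<beta>
  show "tensor_hcomp p (tensor H a b) \<beta> = (\<Sum>q\<in>UNIV. tensor H (hcomp H (p \<noteq> q) a) (hcomp H q b)) \<beta>"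
    using bilin_form_hcomp[of \<beta> p] by (simp add: tensor_hcomp_def tensor_def sum_fun_apply)
qed

lemma tensor_hcomp_combination:
  "tensor_hcomp p (s + t) = tensor_hcomp p s + tensor_hcomp p t"
  "tensor_hcomp p (fscale k s) = fscale k (tensor_hcomp p s)" "tensor_hcomp p 0 = 0"
  by (auto simp: tensor_hcomp_def fscale_def fun_eq_iff)

lemma tensor_hcomp_gr:
  assumes "t \<in> tensor_gr H r"
  shows "tensor_hcomp p t = (if r = p then t else 0)"
  using assms unfolding tensor_gr_def
proof (induction rule: FF.span_induct_alt)
  case base
  show ?case by (simp only: tensor_hcomp_combination if_cancel)
next
  case (step k s t)
  from step(1) obtain a b q q' where "s = tensor H a b" "a \<in> gr H q" "b \<in> gr H q'" "(q \<noteq> q') = r" by blast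
  then have "tensor_hcomp p s = (if r = p then s else 0)"
    by (cases p; cases q; cases q') (auto simp: tensor_hcomp_tensor UNIV_bool hcomp_hom[OF S] tensor_zero)
  then show ?case using step(2) by (simp only: tensor_hcomp_combination) simp
qed

text \<open>The coproduct preserves parity, so it commutes with the projections. This controls the
  coproducts of homogeneous components of elements of a subcoalgebra.\<close>

lemma comult_hcomp: "comult H (hcomp H p c) = tensor_hcomp p (comult H c)"
proof -
  have "comult H c = comult H (hcomp H False c) + comult H (hcomp H True c)"
    by (simp add: hcomp_split flip: comult_add)
  then have "tensor_hcomp p (comult H c) =
      tensor_hcomp p (comult H (hcomp H False c)) + tensor_hcomp p (comult H (hcomp H True c))"
    by (simp only: tensor_hcomp_combination)
  also have "\<dots> = comult H (hcomp H p c)"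
    using tensor_hcomp_gr[OF comult_gr[OF hcomp_mem(1)[OF S]], of p _ c] by (cases p) simp_all
  finally show ?thesis by simp
qed

text \<open>The span provided by \<open>finite_subcoalgebra\<close> need not be graded. Replacing
  its spanning set \<open>B\<close> by the set \<open>E\<close> of homogeneous components keeps it
  finite, and parity projections carry the tensors over \<open>B\<close> into the tensors over
  \<open>E\<close>.\<close>

theorem finite_dim_subsupercoalgebra:
  "\<exists>D. subsupercoalgebra H D \<and> fin_dim H D \<and> c \<in> D"
proof -
  obtain B where B: "finite B" "c \<in> span B" "\<And>b. b \<in> B \<Longrightarrow> comult H b \<in> tensor_sub H B B"
    using finite_subcoalgebra by metis
  define E where "E = (\<Union>p. hcomp H p ` B)"
  have E: "hcomp H p b \<in> E" if "b \<in> B" for p b using that by (auto simp: E_def)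
  have BE: "B \<subseteq> span E"
  proof
    fix b assume "b \<in> B"
    then have "hcomp H False b + hcomp H True b \<in> span E" by (intro span_add span_base E)
    then show "b \<in> span E" by (simp add: hcomp_split)
  qed
  have \<Delta>E: "comult H d \<in> tensor_sub H E E" if "d \<in> E" for d
  proof -
    from that obtain p b where pb: "b \<in> B" "d = hcomp H p b" unfolding E_def by blast
    have "tensor_hcomp p t \<in> tensor_sub H E E" if "t \<in> tensor_sub H B B" for t
      using that unfolding tensor_sub_def[of _ B]
    proof (induction rule: FF.span_induct_alt)
      case base
      show ?case by (simp only: tensor_hcomp_combination tensor_sub_def FF.span_zero)
    next
      case (step k s t)
      then obtain a b where s: "s = tensor H a b" "a \<in> B" "b \<in> B" by blast
      have "tensor_hcomp p s \<in> tensor_sub H E E"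
        unfolding s(1) tensor_hcomp_tensor tensor_sub_def
        by (intro FF.span_sum FF.span_base) (use s E in blast)
      then show ?case using step(2)
        unfolding tensor_hcomp_combination tensor_sub_def by (intro FF.span_add FF.span_scale)
    qed
    then show ?thesis using B(3) pb by (simp add: comult_hcomp)
  qed
  have "subsupercoalgebra H (span E)"
    unfolding subsupercoalgebra_def
  proof (intro conjI allI ballI subspace_span)
    fix p d assume "d \<in> span E"
    then show "hcomp H p d \<in> span E"
    proof (induction rule: span_induct_alt)
      case base
      show ?case using hcomp_add[of p 0 0] span_zero by simp
    next
      case (step k a y)
      then obtain q b where "b \<in> B" "a = hcomp H q b" by (auto simp: E_def)
      then have "hcomp H p a \<in> span E"
        using hcomp_hom[OF S hcomp_mem(1)[OF S, of q b], of p] E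
        by (auto intro: span_base simp: span_zero)
      then show ?case using step(2) by (simp add: hcomp_add hcomp_scale span_add span_scale)
    qed
  next
    fix d assume "d \<in> span E"
    then show "comult H d \<in> tensor_sub H (span E) (span E)"
    proof (induction rule: span_induct_alt)
      case base
      have "comult H 0 = 0" using comult_add[of 0 0] by simp
      then show ?case by (simp only: tensor_sub_def FF.span_zero)
    next
      case (step k a y)
      have "comult H a \<in> tensor_sub H (span E) (span E)"
        using \<Delta>E[OF step(1)] tensor_sub_mono[OF span_superset span_superset] by blast
      then show ?case using step(2)
        unfolding comult_add comult_scale tensor_sub_def by (intro FF.span_add FF.span_scale)
    qed
  qed
  moreover have "fin_dim H (span E)" 
    unfolding fin_dim_def by (rule exI[of _ E]) (simp add: E_def B(1))
  moreover have "c \<in> span E" using B(2) span_minimal[OF BE subspace_span] by blast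
  ultimately show ?thesis by blast
qed

lemma finite_dim_subsupercoalgebra_span:
  assumes "finite B"
  shows "\<exists>D. subsupercoalgebra H D \<and> fin_dim H D \<and> span B \<subseteq> D"
proof -
  have "\<exists>D. subsupercoalgebra H D \<and> fin_dim H D \<and> B \<subseteq> D"
    using assms
  proof induction
    case empty
    show ?case using finite_dim_subsupercoalgebra by blast
  next
    case (insert b B)
    then obtain D where D: "subsupercoalgebra H D" "fin_dim H D" "B \<subseteq> D" by blast
    obtain E where E: "subsupercoalgebra H E" "fin_dim H E" "b \<in> E"
      using finite_dim_subsupercoalgebra by blast
    show ?case using subsupercoalgebra_sum[OF H D(1,2) E(1,2)] D(3) E(3) by blast
  qed
  then show ?thesis by (meson span_minimal subsupercoalgebra_def)
qed

end

section \<open>Determinants over the centre\<close>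

text \<open>
  Even elements of a supercommutative superalgebra are central. The centre is made a type, of class
  \<open>comm_ring_1\<close>, so that the multiplicativity of determinants is available for matrices of even elements.
\<close>

lemma central_mult:
  fixes u v :: "'a::semigroup_mult"
  assumes u: "\<And>a. u * a = a * u" and v: "\<And>a. v * a = a * v"
  shows "u * v * a = a * (u * v)"
proof -
  have "u * v * a = u * (a * v)" by (simp only: mult.assoc v[of a])
  also have "\<dots> = a * (u * v)" by (simp only: mult.assoc[symmetric] u[of a])
  finally show ?thesis .
qed

typedef (overloaded) 'a central = "{z :: 'a::ring_1. \<forall>a. z * a = a * z}"
  by (rule exI[of _ 0]) simp

setup_lifting type_definition_central

instantiation central :: (ring_1) comm_ring_1
begin

lift_definition zero_central :: "'a central" is 0 by simp
lift_definition one_central :: "'a central" is 1 by simp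
lift_definition plus_central :: "'a central \<Rightarrow> 'a central \<Rightarrow> 'a central" is "(+)"
  by (simp add: distrib_left distrib_right)
lift_definition minus_central :: "'a central \<Rightarrow> 'a central \<Rightarrow> 'a central" is "(-)"
  by (simp add: left_diff_distrib right_diff_distrib)
lift_definition uminus_central :: "'a central \<Rightarrow> 'a central" is uminus
  by simp
lift_definition times_central :: "'a central \<Rightarrow> 'a central \<Rightarrow> 'a central" is "(*)"
  by (rule central_mult)

instance
proof
  fix a b c :: "'a central"
  show "a * b * c = a * (b * c)" by transfer (rule mult.assoc)
  show "a * b = b * a" by transfer blast
  show "1 * a = a" by transfer (rule mult_1_left)
  show "a + b + c = a + (b + c)" by transfer (rule add.assoc)
  show "a + b = b + a" by transfer (rule add.commute)
  show "0 + a = a" by transfer (rule add_0)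
  show "- a + a = 0" by transfer (rule left_minus)
  show "a - b = a + - b" by transfer (rule diff_conv_add_uminus)
  show "(a + b) * c = a * c + b * c" by transfer (rule distrib_right)
  show "(0 :: 'a central) \<noteq> 1" by transfer (rule zero_neq_one)
qed

end

lemma Rep_central_simps:
  "Rep_central 0 = 0" "Rep_central 1 = 1" "Rep_central (u + v) = Rep_central u + Rep_central v"
  "Rep_central (u - v) = Rep_central u - Rep_central v" "Rep_central (- u) = - Rep_central u"
  "Rep_central (u * v) = Rep_central u * Rep_central v"
  by (transfer; rule refl)+

lemma Rep_central_power: "Rep_central (u ^ n) = Rep_central u ^ n"
  by (induction n) (simp_all add: Rep_central_simps)

lemma Rep_central_sum: "Rep_central (sum f S) = (\<Sum>i\<in>S. Rep_central (f i))"
  by (induction S rule: infinite_finite_induct) (simp_all add: Rep_central_simps)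

lemma Rep_central_prod_list: "Rep_central (prod_list us) = prod_list (map Rep_central us)"
  by (induction us) (simp_all add: Rep_central_simps)

lemma Rep_central_of_int: "Rep_central (of_int k) = of_int k"
  by (induction k rule: int_induct[where k = 0]) (simp_all add: Rep_central_simps)

section \<open>Nilpotent elements and unipotent determinants over a subring\<close>

definition subring_set :: "'c::comm_ring_1 set \<Rightarrow> bool" where
  "subring_set R \<longleftrightarrow> 1 \<in> R \<and> (\<forall>a\<in>R. \<forall>b\<in>R. a - b \<in> R \<and> a * b \<in> R)"

text \<open>The nilradical of \<open>R\<close>. Membership in \<open>R\<close> is recorded so that
  inverses built from these elements remain in \<open>R\<close>.\<close>

definition nil_ideal :: "'c::comm_ring_1 set \<Rightarrow> 'c set" where
  "nil_ideal R = {a \<in> R. \<exists>n. a ^ n = 0}"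

context
  fixes R :: "'c::comm_ring_1 set"
  assumes R: "subring_set R"
begin

lemma subring_one: "1 \<in> R" and subring_diff: "a \<in> R \<Longrightarrow> b \<in> R \<Longrightarrow> a - b \<in> R"
  and subring_mult: "a \<in> R \<Longrightarrow> b \<in> R \<Longrightarrow> a * b \<in> R"
  using R by (auto simp: subring_set_def)

lemma subring_zero: "0 \<in> R"
  using subring_diff[OF subring_one subring_one] by simp

lemma subring_uminus: "a \<in> R \<Longrightarrow> - a \<in> R"
  using subring_diff[OF subring_zero] by simp

lemma subring_add: "a \<in> R \<Longrightarrow> b \<in> R \<Longrightarrow> a + b \<in> R"
  using subring_diff[OF _ subring_uminus] by fastforce

lemma subring_sum: "(\<And>i. i \<in> S \<Longrightarrow> f i \<in> R) \<Longrightarrow> sum f S \<in> R"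
  by (induction S rule: infinite_finite_induct) (auto intro: subring_zero subring_add)

lemma subring_prod: "(\<And>i. i \<in> S \<Longrightarrow> f i \<in> R) \<Longrightarrow> prod f S \<in> R"
  by (induction S rule: infinite_finite_induct) (auto intro: subring_one subring_mult)

lemma subring_power: "a \<in> R \<Longrightarrow> a ^ n \<in> R"
  by (induction n) (auto intro: subring_one subring_mult)

lemma subring_det:
  assumes A: "A \<in> carrier_mat N N" and mem: "\<And>i j. i < N \<Longrightarrow> j < N \<Longrightarrow> A $$ (i, j) \<in> R"
  shows "det A \<in> R"
  unfolding det_def'[OF A]
proof (intro subring_sum subring_mult subring_prod)
  fix \<pi> i assume "\<pi> \<in> {\<pi>. \<pi> permutes {0..<N}}" "i \<in> {0..<N}"
  then show "A $$ (i, \<pi> i) \<in> R" using mem permutes_in_image by fastforce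
next
  fix \<pi> :: "nat \<Rightarrow> nat"
  show "of_int (sign \<pi>) \<in> R" by (simp add: sign_def subring_one subring_uminus)
qed

lemma nil_add:
  assumes "a \<in> nil_ideal R" "b \<in> nil_ideal R"
  shows "a + b \<in> nil_ideal R"
proof -
  obtain k l where kl: "a ^ k = 0" "b ^ l = 0" using assms by (auto simp: nil_ideal_def)
  \<comment> \<open>In every binomial term either the exponent of \<open>a\<close> is at least
    \<open>k\<close> or that of \<open>b\<close> is at least \<open>l\<close>.\<close>
  have "a ^ i * b ^ (k + l - i) = 0" if "i \<le> k + l" for i
  proof (cases "k \<le> i")
    case True
    then have "a ^ i = a ^ k * a ^ (i - k)" by (simp flip: power_add)
    then show ?thesis using kl by simp
  next
    case False
    then have "b ^ (k + l - i) = b ^ l * b ^ (k - i)" by (simp add: add.commute flip: power_add)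
    then show ?thesis using kl by simp
  qed
  then have "(a + b) ^ (k + l) = 0"
    unfolding binomial_ring by (intro sum.neutral) (auto simp: mult.assoc)
  then show ?thesis using assms by (auto simp: nil_ideal_def intro: subring_add)
qed

lemma nil_mult: "a \<in> nil_ideal R \<Longrightarrow> b \<in> R \<Longrightarrow> a * b \<in> nil_ideal R"
  unfolding nil_ideal_def by (auto intro: subring_mult) (metis power_mult_distrib mult_zero_left)

lemma nil_zero: "0 \<in> nil_ideal R"
  unfolding nil_ideal_def using subring_zero power_one_right by blast

lemma nil_sum: "(\<And>i. i \<in> S \<Longrightarrow> f i \<in> nil_ideal R) \<Longrightarrow> sum f S \<in> nil_ideal R"
  by (induction S rule: infinite_finite_induct) (auto intro: nil_zero nil_add)

lemma nil_uminus: "a \<in> nil_ideal R \<Longrightarrow> - a \<in> nil_ideal R"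
  using nil_mult[OF _ subring_uminus[OF subring_one], of a] by simp

lemma nil_subset: "nil_ideal R \<subseteq> R"
  by (auto simp: nil_ideal_def)

lemma unipotent_prod:
  "(\<And>i. i \<in> S \<Longrightarrow> f i - 1 \<in> nil_ideal R) \<Longrightarrow> prod f S - 1 \<in> nil_ideal R"
proof (induction S rule: infinite_finite_induct)
  case (insert i S)
  have "prod f S - 1 \<in> nil_ideal R" "f i - 1 \<in> nil_ideal R" using insert by auto
  moreover from this have "prod f S \<in> R"
    using nil_subset subring_add[OF _ subring_one, of "prod f S - 1"] by auto
  \<comment> \<open>With \<open>P = prod f S\<close>, one has
    \<open>f i * P - 1 = (f i - 1) * P + (P - 1)\<close>.\<close>
  ultimately have "(f i - 1) * prod f S + (prod f S - 1) \<in> nil_ideal R"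
    by (intro nil_add nil_mult)
  then show ?case using insert by (simp add: algebra_simps)
qed (simp_all add: nil_zero)

text \<open>In the Leibniz expansion a permutation other than \<open>id\<close> moves some index and
  so contributes a nilpotent off-diagonal factor. The term of \<open>id\<close> is a product of
  diagonal entries, each \<open>1\<close> plus a nilpotent.\<close>

lemma unipotent_det:
  assumes A: "A \<in> carrier_mat N N"
    and nil: "\<And>i j. i < N \<Longrightarrow> j < N \<Longrightarrow> A $$ (i, j) - (if i = j then 1 else 0) \<in> nil_ideal R"
  shows "det A - 1 \<in> nil_ideal R"
proof -
  have mem: "A $$ (i, j) \<in> R" if "i < N" "j < N" for i j
    using nil[OF that] nil_subset subring_add[OF _ subring_one, of "A $$ (i, j) - 1"]
    by (auto split: if_splits)
  have in_range: "\<pi> i < N" if "\<pi> permutes {0..<N}" "i < N" for \<pi> i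
    using permutes_in_image[OF that(1), of i] that(2) by simp
  define t where "t \<pi> = of_int (sign \<pi>) * (\<Prod>i = 0..<N. A $$ (i, \<pi> i))" for \<pi>
  have other: "t \<pi> \<in> nil_ideal R" if \<pi>: "\<pi> \<in> {\<pi>. \<pi> permutes {0..<N}} - {id}" for \<pi>
  proof -
    have p: "\<pi> permutes {0..<N}" using \<pi> by simp
    obtain i where i: "i \<in> {0..<N}" "\<pi> i \<noteq> i"
      using \<pi> permutes_not_in[OF p] by (auto simp: fun_eq_iff)
    have "(\<Prod>j\<in>{0..<N} - {i}. A $$ (j, \<pi> j)) \<in> R"
      by (rule subring_prod) (use mem in_range[OF p] in simp)
    moreover have "A $$ (i, \<pi> i) \<in> nil_ideal R"
      using nil[of i "\<pi> i"] i in_range[OF p] by auto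
    ultimately have "(\<Prod>j\<in>{0..<N}. A $$ (j, \<pi> j)) \<in> nil_ideal R"
      using i by (simp add: prod.remove[of _ i] nil_mult)
    then show ?thesis
      unfolding t_def by (auto simp: sign_def nil_uminus)
  qed
  have "det A = (\<Sum>\<pi> | \<pi> permutes {0..<N}. t \<pi>)"
    unfolding det_def'[OF A] t_def ..
  also have "\<dots> = t id + (\<Sum>\<pi>\<in>{\<pi>. \<pi> permutes {0..<N}} - {id}. t \<pi>)"
    by (rule sum.remove) (simp_all add: finite_permutations permutes_id)
  finally have split: "det A - 1 = (t id - 1) + (\<Sum>\<pi>\<in>{\<pi>. \<pi> permutes {0..<N}} - {id}. t \<pi>)"
    by simp
  have "t id - 1 \<in> nil_ideal R"
    unfolding t_def sign_id of_int_1 mult_1_left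
    by (rule unipotent_prod) (use nil[of i i for i] in fastforce)
  then show ?thesis unfolding split by (rule nil_add) (rule nil_sum[OF other])
qed

text \<open>The inverse is the geometric series in \<open>1 - a\<close>, which is finite by
  nilpotency and therefore stays in \<open>R\<close>.\<close>

lemma unipotent_inverse:
  assumes "a - 1 \<in> nil_ideal R"
  obtains b where "b \<in> R" "a * b = 1"
proof -
  define u where "u = 1 - a"
  have u: "u \<in> nil_ideal R" using nil_uminus[OF assms] by (simp add: u_def)
  then obtain n where n: "u ^ n = 0" "u \<in> R" by (auto simp: nil_ideal_def)
  have "(1 - u) * (\<Sum>i<n. u ^ i) = 1"
    using n one_diff_power_eq[of u n] by simp
  then have "a * (\<Sum>i<n. u ^ i) = 1" by (simp add: u_def)
  moreover have "(\<Sum>i<n. u ^ i) \<in> R" using n by (intro subring_sum subring_power)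
  ultimately show ?thesis using that by blast
qed

end

text \<open>The block is bordered by an identity matrix, so that both diagonal blocks become matrices with
  indices in \<open>{0..<N}\<close>.\<close>

lemma block_det_central:
  fixes x :: "nat \<Rightarrow> nat \<Rightarrow> 'a::ring_1"
  assumes hi: "hi \<le> N" and X: "\<And>i j. i \<in> {lo..<hi} \<Longrightarrow> j \<in> {lo..<hi} \<Longrightarrow> Rep_central (X i j) = x i j"
  shows "Rep_central (det (mat N N (\<lambda>(i, j).
      if i \<in> {lo..<hi} \<and> j \<in> {lo..<hi} then X i j else if i = j then 1 else 0))) = block_det lo hi x"
proof -
  define M where "M i j = (if i \<in> {lo..<hi} \<and> j \<in> {lo..<hi} then X i j else if i = j then 1 else 0)"
    for i j
  define t where "t \<pi> = of_int (sign \<pi>) * (\<Prod>i = 0..<N. M i (\<pi> i))" for \<pi>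
  have "det (mat N N (\<lambda>(i, j). M i j)) = (\<Sum>\<pi> | \<pi> permutes {0..<N}. t \<pi>)"
    unfolding t_def
    by (subst det_def'[of _ N]) (auto intro!: sum.cong prod.cong arg_cong2[of _ _ _ _ times] simp: permutes_in_image)
  also have "\<dots> = (\<Sum>\<pi> | \<pi> permutes {lo..<hi}. t \<pi>)"
  proof (rule sum.mono_neutral_right)
    show "{\<pi>. \<pi> permutes {lo..<hi}} \<subseteq> {\<pi>. \<pi> permutes {0..<N}}"
      using hi by (auto intro: permutes_subset)
    show "\<forall>\<pi>\<in>{\<pi>. \<pi> permutes {0..<N}} - {\<pi>. \<pi> permutes {lo..<hi}}. t \<pi> = 0"
    proof
      fix \<pi> assume \<pi>: "\<pi> \<in> {\<pi>. \<pi> permutes {0..<N}} - {\<pi>. \<pi> permutes {lo..<hi}}"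
      then have p: "\<pi> permutes {0..<N}" by simp
      \<comment> \<open>A permutation that fixes every index outside the block permutes the block.
        Hence some outside index \<open>i\<close> is moved, and row \<open>i\<close> of the bordered
        matrix is a row of the identity.\<close>
      obtain i where i: "i \<in> {0..<N} - {lo..<hi}" "\<pi> i \<noteq> i"
        using \<pi> permutes_superset[OF p, of "{lo..<hi}"] by auto
      then have "M i (\<pi> i) = 0" by (auto simp: M_def)
      then have "(\<Prod>i = 0..<N. M i (\<pi> i)) = 0" using i by (intro prod_zero) auto
      then show "t \<pi> = 0" by (simp add: t_def)
    qed
  qed (simp add: finite_permutations)
  finally have "Rep_central (det (mat N N (\<lambda>(i, j). M i j))) =
      (\<Sum>\<pi> | \<pi> permutes {lo..<hi}. Rep_central (t \<pi>))" by (simp add: Rep_central_sum)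
  also have "\<dots> = block_det lo hi x"
    unfolding block_det_def
  proof (rule sum.cong[OF refl])
    fix \<pi> assume "\<pi> \<in> {\<pi>. \<pi> permutes {lo..<hi}}"
    then have p: "\<pi> permutes {lo..<hi}" by simp
    have "(\<Prod>i = 0..<N. M i (\<pi> i)) = (\<Prod>i = lo..<hi. M i (\<pi> i))"
      by (rule prod.mono_neutral_right) (use hi permutes_not_in[OF p] in \<open>auto simp: M_def\<close>)
    also have "\<dots> = prod_list (map (\<lambda>i. M i (\<pi> i)) [lo..<hi])"
      using prod.distinct_set_conv_list[of "[lo..<hi]" "\<lambda>i. M i (\<pi> i)"] by simp
    finally have "Rep_central (\<Prod>i = 0..<N. M i (\<pi> i)) =
        prod_list (map (\<lambda>i. Rep_central (M i (\<pi> i))) [lo..<hi])"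
      by (simp add: Rep_central_prod_list comp_def)
    also have "map (\<lambda>i. Rep_central (M i (\<pi> i))) [lo..<hi] = map (\<lambda>i. x i (\<pi> i)) [lo..<hi]"
      using permutes_in_image[OF p] by (auto simp: M_def X)
    finally show "Rep_central (t \<pi>) = of_int (sign \<pi>) * prod_list (map (\<lambda>i. x i (\<pi> i)) [lo..<hi])"
      by (simp add: t_def Rep_central_simps Rep_central_of_int)
  qed
  finally show ?thesis by (simp add: M_def)
qed

section \<open>The coordinate superalgebra is the sum of the coefficient spaces\<close>

locale gl_coordinate =
  fixes m n :: nat and H :: "('k::field, 'a::ring_1) hopf_data" and x :: "nat \<Rightarrow> nat \<Rightarrow> 'a"
  assumes GL: "GL_coordinate_hopf_superalgebra m n H x"
begin

section \<open>Parity, commutation rules and the antipode in the coordinate superalgebra\<close>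

lemma hopf: "hopf_superalgebra H" and scomm: "supercommutative H"
  using GL by (simp_all add: GL_coordinate_hopf_superalgebra_def)

lemma superalg: "superalgebra H" and supercoalgebra: "supercoalgebra H"
  using hopf by (simp_all add: hopf_superalgebra_def)

sublocale supercoalg H
  by unfold_locales (rule supercoalgebra)

lemma scale_mult_left: "sc H k a * b = sc H k (a * b)"
  and scale_mult_right: "a * sc H k b = sc H k (a * b)"
proof -
  have ax: "\<forall>k a b. sc H k (a * b) = sc H k a * b \<and> sc H k (a * b) = a * sc H k b"
    using superalg unfolding superalgebra_def by blast
  show "sc H k a * b = sc H k (a * b)" using ax by simp
  show "a * sc H k b = sc H k (a * b)" by (rule ax[rule_format, THEN conjunct2, symmetric])
qed

lemma one_even: "1 \<in> gr H False"
  and gr_mult: "a \<in> gr H p \<Longrightarrow> b \<in> gr H q \<Longrightarrow> a * b \<in> gr H (p \<noteq> q)"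
  using superalg unfolding superalgebra_def by blast+

lemma supercommute: "a \<in> gr H p \<Longrightarrow> b \<in> gr H q \<Longrightarrow> a * b = sc H (ksign p q) (b * a)"
  using scomm unfolding supercommutative_def by blast

lemma even_central:
  assumes "a \<in> gr H False"
  shows "a * b = b * a"
proof -
  have "a * hcomp H q b = hcomp H q b * a" for q
    using supercommute[OF assms hcomp_mem(1)[OF S], of q b] by (simp add: ksign_def)
  then have "a * (hcomp H False b + hcomp H True b) = (hcomp H False b + hcomp H True b) * a"
    by (simp add: distrib_left distrib_right)
  then show ?thesis by (simp add: hcomp_split)
qed

text \<open>Supercommutativity gives \<open>b * b = - (b * b)\<close>; here characteristic different
  from two enters.\<close>

lemma odd_square:
  assumes two: "(1 + 1 :: 'k) \<noteq> 0" and b: "b \<in> gr H True"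
  shows "b * b = 0"
proof -
  have "b * b = - (b * b)"
    using supercommute[OF b b] by (simp add: ksign_def)
  then have "sc H (1 + 1) (b * b) = 0"
    by (simp only: scale_left_distrib scale_one) (metis add.right_inverse)
  then show ?thesis using two scale_eq_0_iff by blast
qed

abbreviation y :: "nat \<Rightarrow> nat \<Rightarrow> 'a" where "y i j \<equiv> antip H (x i j)"

lemma x_gr: "i < m + n \<Longrightarrow> j < m + n \<Longrightarrow> x i j \<in> gr H (gen_par m i j)"
  using GL by (simp add: GL_coordinate_hopf_superalgebra_def)

lemma y_gr: "i < m + n \<Longrightarrow> j < m + n \<Longrightarrow> y i j \<in> gr H (gen_par m i j)"
  using x_gr[of i j] hopf unfolding hopf_superalgebra_def image_subset_iff by simp

text \<open>The antipode axiom for the given coproduct of \<open>x i j\<close> is the matrix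
  identity \<open>Y X = 1\<close>.\<close>

lemma y_x:
  assumes ij: "i < m + n" "j < m + n"
  shows "(\<Sum>k<m+n. y i k * x k j) = (if i = j then 1 else 0)"
proof -
  have "comult H (x i j) = (\<Sum>k<m+n. tensor H (x i k) (x k j))"
    and eps: "counit H (x i j) = (if i = j then 1 else 0)"
    using GL ij by (simp_all add: GL_coordinate_hopf_superalgebra_def)
  then have "sweedler H (x i j) (map (\<lambda>k. (x i k, x k j)) [0..<m+n])"
    by (simp add: sweedler_def comp_def sum_list_distinct_conv_sum_set atLeast0LessThan)
  then have "(\<Sum>(a, b)\<leftarrow>map (\<lambda>k. (x i k, x k j)) [0..<m+n]. antip H a * b) =
      sc H (counit H (x i j)) 1"
    using hopf unfolding hopf_superalgebra_def by blast
  then show ?thesis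
    by (simp add: comp_def sum_list_distinct_conv_sum_set atLeast0LessThan eps split: if_splits)
qed

section \<open>Words in the generators and the algebra they span\<close>

abbreviation xprod :: "(nat \<times> nat) list \<Rightarrow> 'a" where
  "xprod us \<equiv> prod_list (map (\<lambda>(i, j). x i j) us)"

abbreviation yprod :: "(nat \<times> nat) list \<Rightarrow> 'a" where
  "yprod vs \<equiv> prod_list (map (\<lambda>(i, j). y i j) vs)"

abbreviation idx :: "(nat \<times> nat) set" where
  "idx \<equiv> {..<m+n} \<times> {..<m+n}"

definition words :: "nat \<Rightarrow> nat \<Rightarrow> 'a set" where
  "words l s = {xprod us * yprod vs | us vs. length us = l \<and> length vs = s \<and> set us \<union> set vs \<subseteq> idx}"

lemma coeff_space_words: "coeff_space m n H x l s = span (words l s)"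
  by (simp add: coeff_space_def words_def)

lemma finite_words: "finite (words l s)"
proof -
  have "words l s \<subseteq> (\<lambda>(us, vs). xprod us * yprod vs) `
      ({us. set us \<subseteq> idx \<and> length us = l} \<times> {vs. set vs \<subseteq> idx \<and> length vs = s})"
    by (auto simp: words_def)
  then show ?thesis
    by (rule finite_subset) (intro finite_imageI finite_cartesian_product finite_lists_length_eq; simp)
qed

lemma xprod_gr: "set us \<subseteq> idx \<Longrightarrow> \<exists>p. xprod us \<in> gr H p"
proof (induction us)
  case (Cons ij us)
  then obtain p where p: "xprod us \<in> gr H p" by auto
  obtain i j where "ij = (i, j)" "i < m + n" "j < m + n" using Cons.prems by auto
  then show ?case using gr_mult[OF x_gr p, of i j] by (intro exI) simp
qed (use one_even in auto)

lemma yprod_gr: "set us \<subseteq> idx \<Longrightarrow> \<exists>p. yprod us \<in> gr H p"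
proof (induction us)
  case (Cons ij us)
  then obtain p where p: "yprod us \<in> gr H p" by auto
  obtain i j where "ij = (i, j)" "i < m + n" "j < m + n" using Cons.prems by auto
  then show ?case using gr_mult[OF y_gr p, of i j] by (intro exI) simp
qed (use one_even in auto)

text \<open>The sum of all coefficient spaces; \<open>alg_UNIV\<close> shows that it is the whole
  coordinate superalgebra.\<close>

definition alg :: "'a set" where
  "alg = span (\<Union>l s. words l s)"

lemma words_alg: "set us \<subseteq> idx \<Longrightarrow> set vs \<subseteq> idx \<Longrightarrow> xprod us * yprod vs \<in> alg"
  unfolding alg_def by (rule span_base) (auto simp: words_def)

lemma alg_diff: "a \<in> alg \<Longrightarrow> b \<in> alg \<Longrightarrow> a - b \<in> alg"
  and alg_scale: "a \<in> alg \<Longrightarrow> sc H k a \<in> alg"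
  unfolding alg_def by (simp_all add: span_diff span_scale)

text \<open>Words are homogeneous, so the \<open>y\<close> factors of the first word move past the
  \<open>x\<close> factors of the second at the cost of a sign, and the product is again a word up
  to that sign.\<close>

lemma alg_mult:
  assumes "a \<in> alg" "b \<in> alg"
  shows "a * b \<in> alg"
proof -
  have gens: "w * w' \<in> alg" if w: "w \<in> (\<Union>l s. words l s)" "w' \<in> (\<Union>l s. words l s)" for w w'
  proof -
    obtain us vs us' vs' where w: "w = xprod us * yprod vs" "w' = xprod us' * yprod vs'"
      and sub: "set us \<subseteq> idx" "set vs \<subseteq> idx" "set us' \<subseteq> idx" "set vs' \<subseteq> idx"
      using w by (auto simp: words_def)
    obtain p q where "yprod vs \<in> gr H p" "xprod us' \<in> gr H q"
      using xprod_gr[OF sub(3)] yprod_gr[OF sub(2)] by blast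
    then have comm: "yprod vs * xprod us' = sc H (ksign p q) (xprod us' * yprod vs)"
      by (rule supercommute)
    have "w * w' = xprod us * (yprod vs * xprod us') * yprod vs'"
      unfolding w by (simp only: mult.assoc)
    also have "\<dots> = sc H (ksign p q) (xprod (us @ us') * yprod (vs @ vs'))"
      unfolding comm by (simp add: scale_mult_left scale_mult_right mult.assoc)
    finally show ?thesis using words_alg[of "us @ us'" "vs @ vs'"] sub by (simp add: alg_scale)
  qed
  have left: "w * b \<in> alg" if w: "w \<in> (\<Union>l s. words l s)" for w
    using assms(2) unfolding alg_def
  proof (induction rule: span_induct_alt)
    case base
    show ?case by (simp add: span_zero)
  next
    case (step k w' z)
    then show ?case
      using gens[OF w step(1)] by (simp add: distrib_left scale_mult_right alg_def span_add span_scale)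
  qed
  show ?thesis
    using assms(1) unfolding alg_def
  proof (induction rule: span_induct_alt)
    case base
    show ?case by (simp add: span_zero)
  next
    case (step k w z)
    then show ?case
      using left[OF step(1)] by (simp add: distrib_right scale_mult_left alg_def span_add span_scale)
  qed
qed

lemma alg_one: "1 \<in> alg"
  using words_alg[of "[]" "[]"] by simp

lemma alg_x: "i < m + n \<Longrightarrow> j < m + n \<Longrightarrow> x i j \<in> alg"
  using words_alg[of "[(i, j)]" "[]"] by simp

lemma alg_y: "i < m + n \<Longrightarrow> j < m + n \<Longrightarrow> y i j \<in> alg"
  using words_alg[of "[]" "[(i, j)]"] by simp

lemma alg_power: "a \<in> alg \<Longrightarrow> a ^ k \<in> alg"
  by (induction k) (auto intro: alg_one alg_mult)

lemma alg_prod_list: "set as \<subseteq> alg \<Longrightarrow> prod_list as \<in> alg"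
  by (induction as) (auto intro: alg_one alg_mult)

section \<open>Inverting the determinant inside the generated algebra\<close>

definition central_alg :: "'a central set" where
  "central_alg = {c. Rep_central c \<in> alg}"

lemma subring_central_alg: "subring_set central_alg"
  by (simp add: subring_set_def central_alg_def Rep_central_simps alg_one alg_diff alg_mult)

lemma Rep_Abs_even: "a \<in> gr H False \<Longrightarrow> Rep_central (Abs_central a) = a"
  by (rule Abs_central_inverse) (simp add: even_central)

text \<open>For an even diagonal block, \<open>Y X = 1\<close> shows that the blocks of \<open>Y\<close> and \<open>X\<close> are inverse to each
  other up to products of two odd elements, which are nilpotent.\<close>

lemma block_det_invertible:
  assumes two: "(1 + 1 :: 'k) \<noteq> 0" and hi: "hi \<le> m + n"
    and blk: "\<And>i j. i \<in> {lo..<hi} \<Longrightarrow> j < m + n \<Longrightarrow> gen_par m i j \<longleftrightarrow> j \<notin> {lo..<hi}"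
    and blk': "\<And>i j. i \<in> {lo..<hi} \<Longrightarrow> j < m + n \<Longrightarrow> gen_par m j i \<longleftrightarrow> j \<notin> {lo..<hi}"
  shows "\<exists>D b. Rep_central D = block_det lo hi x \<and> b \<in> central_alg \<and> D * b = 1"
proof -
  define N where "N = m + n"
  define M where "M z = mat N N (\<lambda>(i, j). if i \<in> {lo..<hi} \<and> j \<in> {lo..<hi} then Abs_central (z i j)
      else if i = j then 1 else 0)" for z :: "nat \<Rightarrow> nat \<Rightarrow> 'a"
  have car: "M z \<in> carrier_mat N N" for z by (simp add: M_def)
  have lt: "i < m + n" if "i \<in> {lo..<hi}" for i using that hi by auto
  have Rx: "Rep_central (Abs_central (x i j)) = x i j" if "i \<in> {lo..<hi}" "j \<in> {lo..<hi}" for i j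
    using x_gr[OF lt lt, of i j] blk[of i j] lt that by (intro Rep_Abs_even) simp
  have Ry: "Rep_central (Abs_central (y i j)) = y i j" if "i \<in> {lo..<hi}" "j \<in> {lo..<hi}" for i j
    using y_gr[OF lt lt, of i j] blk[of i j] lt that by (intro Rep_Abs_even) simp
  let ?nil = "nil_ideal central_alg"
  note sub = subring_central_alg
  have My_alg: "det (M y) \<in> central_alg"
  proof (rule subring_det[OF sub car])
    fix i j assume ij: "i < N" "j < N"
    then have "Abs_central (y i j) \<in> central_alg" if "i \<in> {lo..<hi}" "j \<in> {lo..<hi}"
      using that by (simp add: central_alg_def Ry alg_y N_def)
    then show "M y $$ (i, j) \<in> central_alg"
      using ij subring_one[OF sub] subring_zero[OF sub] by (simp add: M_def)
  qed
  have "det (M y * M x) - 1 \<in> ?nil"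
  proof (rule unipotent_det[OF sub])
    show "M y * M x \<in> carrier_mat N N" using car by (rule mult_carrier_mat[OF _ car])
    fix i j assume ij: "i < N" "j < N"
    have entry: "(M y * M x) $$ (i, j) = (\<Sum>k<N. M y $$ (i, k) * M x $$ (k, j))"
      using ij by (simp add: M_def scalar_prod_def atLeast0LessThan)
    show "(M y * M x) $$ (i, j) - (if i = j then 1 else 0) \<in> ?nil"
    proof (cases "i \<in> {lo..<hi} \<and> j \<in> {lo..<hi}")
      case False
      \<comment> \<open>Outside the block both bordered matrices agree with the identity, hence so
        does their product, without any nilpotent error.\<close>
      have "(M y * M x) $$ (i, j) = (if i = j then 1 else 0)"
      proof (cases "i \<in> {lo..<hi}")
        case True
        then have "j \<notin> {lo..<hi}" "i \<noteq> j" using False by auto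
        then have "M x $$ (k, j) = (if k = j then 1 else 0)" "M y $$ (i, j) = 0" if "k < N" for k
          using that ij by (simp_all add: M_def del: atLeastLessThan_iff)
        then have "M y $$ (i, k) * M x $$ (k, j) = 0" if "k < N" for k
          using that by (cases "k = j") simp_all
        then show ?thesis using \<open>i \<noteq> j\<close> by (simp add: entry)
      next
        case i: False
        then have "M y $$ (i, k) = (if k = i then 1 else 0)" "M x $$ (i, j) = (if i = j then 1 else 0)"
          if "k < N" for k
          using that ij by (simp_all add: M_def del: atLeastLessThan_iff)
        then have "M y $$ (i, k) * M x $$ (k, j) = (if k = i then if i = j then 1 else 0 else 0)"
          if "k < N" for k
          using that by (cases "k = i") simp_all
        then show ?thesis using ij by (simp add: entry)
      qed
      then show ?thesis by (simp add: nil_zero[OF sub])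
    next
      case True
      let ?B = "{lo..<hi}"
      \<comment> \<open>The terms of the \<open>(i, j)\<close> entry of \<open>Y X\<close> whose
        middle index lies outside the block. Both factors are odd, so each product is even and
        therefore central.\<close>
      define W where "W k = Abs_central (y i k * x k j)" for k
      have odd: "y i k \<in> gr H True" "x k j \<in> gr H True" if "k \<in> {..<N} - ?B" for k
        using that y_gr[of i k] x_gr[of k j] blk[of i k] blk'[of j k] True ij by (simp_all add: N_def)
      have RW: "Rep_central (W k) = y i k * x k j" if "k \<in> {..<N} - ?B" for k
        unfolding W_def by (rule Rep_Abs_even) (use gr_mult[OF odd[OF that]] in simp)
      have W: "W k \<in> ?nil" if k: "k \<in> {..<N} - ?B" for k
      proof -
        \<comment> \<open>Exchanging the two inner odd factors turns the square into a multiple of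
          squares of odd elements, which vanish.\<close>
        have "y i k * x k j * (y i k * x k j) = y i k * (x k j * y i k) * x k j"
          by (simp only: mult.assoc)
        also have "\<dots> = - (y i k * y i k * (x k j * x k j))"
          using supercommute[OF odd(2,1)[OF k]]
          by (simp add: ksign_def mult.assoc)
        finally have "Rep_central (W k ^ 2) = Rep_central 0"
          using odd_square[OF two] odd[OF k] by (simp add: power2_eq_square Rep_central_simps RW[OF k])
        then have "W k ^ 2 = 0" by (simp only: Rep_central_inject)
        moreover have "W k \<in> central_alg"
          using k ij by (simp add: central_alg_def RW[OF k] alg_mult alg_x alg_y N_def)
        ultimately show ?thesis unfolding nil_ideal_def by blast
      qed
      have "(M y * M x) $$ (i, j) = (\<Sum>k\<in>?B. Abs_central (y i k) * Abs_central (x k j))"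
      proof -
        have "(\<Sum>k<N. M y $$ (i, k) * M x $$ (k, j)) = (\<Sum>k\<in>?B. M y $$ (i, k) * M x $$ (k, j))"
          by (rule sum.mono_neutral_right) (use hi True ij in \<open>auto simp: M_def N_def\<close>)
        also have "\<dots> = (\<Sum>k\<in>?B. Abs_central (y i k) * Abs_central (x k j))"
          by (rule sum.cong) (use hi True ij in \<open>auto simp: M_def N_def\<close>)
        finally show ?thesis by (simp only: entry)
      qed
      then have "Rep_central ((M y * M x) $$ (i, j)) = (\<Sum>k\<in>?B. y i k * x k j)"
        using True by (simp add: Rep_central_sum Rep_central_simps Rx Ry)
      \<comment> \<open>The block sum is the full sum, known from \<open>Y X = 1\<close>, minus the
        terms \<open>W k\<close>.\<close>
      also have "\<dots> = (\<Sum>k<N. y i k * x k j) - (\<Sum>k\<in>{..<N} - ?B. y i k * x k j)"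
        using hi by (subst sum_diff) (auto simp: N_def)
      also have "\<dots> = Rep_central ((if i = j then 1 else 0) - (\<Sum>k\<in>{..<N} - ?B. W k))"
        using y_x[of i j] ij RW by (simp add: N_def Rep_central_simps Rep_central_sum)
      finally have "(M y * M x) $$ (i, j) = (if i = j then 1 else 0) - (\<Sum>k\<in>{..<N} - ?B. W k)"
        by (simp only: Rep_central_inject)
      moreover have "- (\<Sum>k\<in>{..<N} - ?B. W k) \<in> ?nil"
        by (intro nil_uminus[OF sub] nil_sum[OF sub] W)
      ultimately show ?thesis by simp
    qed
  qed
  then obtain b where b: "b \<in> central_alg" "det (M y * M x) * b = 1"
    by (rule unipotent_inverse[OF sub])
  have "Rep_central (det (M x)) = block_det lo hi x"
    unfolding M_def by (rule block_det_central) (use hi Rx in \<open>auto simp: N_def\<close>)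
  \<comment> \<open>Multiplicativity of the determinant converts the inverse \<open>b\<close> of the
    product determinant into an inverse of \<open>det (M x)\<close>.\<close>
  moreover have "det (M x) * (det (M y) * b) = 1"
    using b(2) by (simp add: det_mult[OF car car] ac_simps)
  moreover have "det (M y) * b \<in> central_alg" using My_alg b(1) by (rule subring_mult[OF sub])
  ultimately show ?thesis by blast
qed

lemma gl_det_invertible:
  assumes two: "(1 + 1 :: 'k) \<noteq> 0"
  shows "\<exists>D b. Rep_central D = gl_det m n x \<and> b \<in> central_alg \<and> D * b = 1"
proof -
  have "\<exists>D b. Rep_central D = block_det 0 m x \<and> b \<in> central_alg \<and> D * b = 1"
    by (rule block_det_invertible[OF two]) (auto simp: gen_par_def idx_par_def)
  then obtain D0 b0 where 0: "Rep_central D0 = block_det 0 m x" "b0 \<in> central_alg" "D0 * b0 = 1"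
    by blast
  have "\<exists>D b. Rep_central D = block_det m (m + n) x \<and> b \<in> central_alg \<and> D * b = 1"
    by (rule block_det_invertible[OF two]) (auto simp: gen_par_def idx_par_def)
  then obtain D1 b1 where 1: "Rep_central D1 = block_det m (m + n) x" "b1 \<in> central_alg" "D1 * b1 = 1"
    by blast
  have "Rep_central (D0 * D1) = gl_det m n x"
    by (simp add: gl_det_def Rep_central_simps 0 1)
  moreover have "b0 * b1 \<in> central_alg" by (rule subring_mult[OF subring_central_alg 0(2) 1(2)])
  moreover have "D0 * D1 * (b0 * b1) = (D0 * b0) * (D1 * b1)" by (simp only: ac_simps)
  then have "D0 * D1 * (b0 * b1) = 1" by (simp add: 0 1)
  ultimately show ?thesis by blast
qed

text \<open>By the localisation property, some power of the determinant times \<open>a\<close> is a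
  combination of standard monomials in the \<open>x i j\<close>, which lie in \<open>alg\<close>;
  multiplying by the same power of the inverse \<open>b\<close> recovers \<open>a\<close>.\<close>

lemma alg_UNIV:
  assumes two: "(1 + 1 :: 'k) \<noteq> 0"
  shows "a \<in> alg"
proof -
  obtain D b where D: "Rep_central D = gl_det m n x" "b \<in> central_alg" "D * b = 1"
    using gl_det_invertible[OF two] by blast
  have "\<forall>a. \<exists>r. gl_det m n x ^ r * a \<in> span (std_monom m n x ` std_exps m n)"
    using GL by (simp add: GL_coordinate_hopf_superalgebra_def)
  then obtain r where r: "gl_det m n x ^ r * a \<in> span (std_monom m n x ` std_exps m n)" by blast
  have "std_monom m n x e \<in> alg" for e
    unfolding std_monom_def by (intro alg_prod_list) (auto intro!: alg_power[OF alg_x])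
  then have "std_monom m n x ` std_exps m n \<subseteq> alg" by blast
  then have "span (std_monom m n x ` std_exps m n) \<subseteq> alg"
    unfolding alg_def by (rule span_minimal) (rule subspace_span)
  then have "Rep_central (b ^ r) * (gl_det m n x ^ r * a) \<in> alg"
    using r subring_power[OF subring_central_alg D(2), of r]
    by (intro alg_mult[of "Rep_central (b ^ r)"]) (auto simp: central_alg_def)
  moreover have "Rep_central (b ^ r) * gl_det m n x ^ r = Rep_central ((D * b) ^ r)"
    by (simp only: D(1)[symmetric] Rep_central_simps(6)[symmetric] Rep_central_power[symmetric]
        power_mult_distrib mult.commute)
  then have "Rep_central (b ^ r) * (gl_det m n x ^ r * a) = a"
    by (simp add: D(3) Rep_central_simps flip: mult.assoc)
  ultimately show ?thesis by simp
qed

text \<open>As \<open>c\<close> is a finite combination of words, finitely many coefficient spaces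
  suffice. The statement is phrased through functionals because kernels of \<open>pi_ls\<close> are
  tested that way.\<close>

lemma coeff_spaces_detect:
  assumes "c \<in> alg"
  shows "\<exists>F. finite F \<and> (\<forall>\<xi>. lin_form H \<xi> \<longrightarrow> (\<forall>(l, s)\<in>F. \<forall>d\<in>coeff_space m n H x l s. \<xi> d = 0) \<longrightarrow> \<xi> c = 0)"
  using assms unfolding alg_def
proof (induction rule: span_induct_alt)
  case base
  show ?case by (rule exI[of _ "{}"]) (simp add: lin_form_zero)
next
  case (step k w z)
  from step(2) obtain F where F: "finite F"
    "\<And>\<xi>. lin_form H \<xi> \<Longrightarrow> (\<forall>(l, s)\<in>F. \<forall>d\<in>coeff_space m n H x l s. \<xi> d = 0) \<Longrightarrow> \<xi> z = 0" by blast
  obtain l s where "w \<in> words l s" using step(1) by blast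
  then have w: "w \<in> coeff_space m n H x l s" unfolding coeff_space_words by (rule span_base)
  show ?case
  proof (intro exI[of _ "insert (l, s) F"] conjI allI impI)
    fix \<xi> assume \<xi>: "lin_form H \<xi>" "\<forall>(l, s)\<in>insert (l, s) F. \<forall>d\<in>coeff_space m n H x l s. \<xi> d = 0"
    then have "\<xi> w = 0" "\<xi> z = 0" using w F(2)[OF \<xi>(1)] by auto
    then show "\<xi> (sc H k w + z) = 0" by (simp add: lin_form_add[OF \<xi>(1)] lin_form_scale[OF \<xi>(1)])
  qed (simp add: F(1))
qed

section \<open>Open superideals\<close>

lemma counit_mult: "counit H (a * b) = counit H a * counit H b"
  using hopf by (simp add: hopf_superalgebra_def)

text \<open>Two adjacent factors are merged into one, which the multiplicative counit still
  annihilates. Monotonicity lets two distributions be compared at the larger of their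
  orders.\<close>

lemma aug_ideal_power_Suc: "aug_ideal_power H (Suc t) \<subseteq> aug_ideal_power H t"
  unfolding aug_ideal_power_def
proof (rule span_mono, rule subsetI)
  fix c assume "c \<in> {prod_list as | as. length as = Suc (Suc t) \<and> (\<forall>a\<in>set as. counit H a = 0)}"
  then obtain as where as: "c = prod_list as" "length as = Suc (Suc t)" "\<forall>a\<in>set as. counit H a = 0"
    by blast
  then obtain a b bs where "as = a # b # bs" by (auto simp: length_Suc_conv)
  then have "c = prod_list (a * b # bs) \<and> length (a * b # bs) = Suc t \<and>
      (\<forall>a\<in>set (a * b # bs). counit H a = 0)"
    using as by (simp add: counit_mult mult.assoc)
  then show "c \<in> {prod_list as | as. length as = Suc t \<and> (\<forall>a\<in>set as. counit H a = 0)}" by blast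
qed

lemma dual_diff: "\<phi> \<in> dual H \<Longrightarrow> \<psi> \<in> dual H \<Longrightarrow> \<phi> - \<psi> \<in> dual H"
  unfolding dual_def
  by (auto intro!: lin_formI[OF vector_space_axioms] simp: lin_form_add lin_form_scale algebra_simps)

lemma Dist_diff:
  assumes "\<phi> \<in> Dist H" "\<psi> \<in> Dist H"
  shows "\<phi> - \<psi> \<in> Dist H"
proof -
  obtain t t' where t: "\<phi> \<in> perp H (aug_ideal_power H t)" "\<psi> \<in> perp H (aug_ideal_power H t')"
    using assms by (auto simp: Dist_def)
  have "aug_ideal_power H (max t t') \<subseteq> aug_ideal_power H t" "aug_ideal_power H (max t t') \<subseteq> aug_ideal_power H t'"
    using lift_Suc_antimono_le[of "aug_ideal_power H", OF aug_ideal_power_Suc] by simp_all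
  then have "\<phi> - \<psi> \<in> perp H (aug_ideal_power H (max t t'))"
    using t dual_diff by (auto simp: perp_def subset_iff)
  then show ?thesis by (auto simp: Dist_def)
qed

lemma Dist_dual: "Dist H \<subseteq> dual H"
  by (auto simp: Dist_def perp_def)

lemma ker_pi_iff:
  "\<xi> \<in> ker_pi m n H x l s \<longleftrightarrow> \<xi> \<in> Dist H \<and> (\<forall>c\<in>coeff_space m n H x l s. \<xi> c = 0)"
  by (auto simp: ker_pi_def pi_ls_def restrict_def fun_eq_iff)

lemma perp_add: "\<phi> \<in> perp H D \<Longrightarrow> \<psi> \<in> perp H D \<Longrightarrow> \<phi> + \<psi> \<in> perp H D"
  unfolding perp_def dual_def
  by (auto intro!: lin_formI[OF vector_space_axioms] simp: lin_form_add lin_form_scale algebra_simps)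

text \<open>In this form \<open>perp_add\<close> also provides closure of the full dual under
  addition.\<close>

lemma dual_eq_perp: "dual H = perp H {}"
  by (simp add: perp_def)

text \<open>Openness at \<open>0\<close> yields \<open>D\<close> whose annihilator meets the
  distributions inside \<open>I\<close>. Each of the finitely many spanning vectors of
  \<open>D\<close> is detected by finitely many coefficient spaces, and these are collected.\<close>

lemma open_superideal_contains:
  assumes two: "(1 + 1 :: 'k) \<noteq> 0" and I: "0 \<in> I"
    and op: "openin (subtopology (dual_topology H) (Dist H)) I"
  shows "\<exists>F. finite F \<and> F \<noteq> {} \<and> (\<Inter>(l, s)\<in>F. ker_pi m n H x l s) \<subseteq> I"
proof -
  obtain U where U: "dual_open H U" "I = U \<inter> Dist H"
    using op by (auto simp: openin_subtopology openin_dual_topology[OF supercoalgebra])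
  then have "0 \<in> U" using I by blast
  then obtain D where D: "fin_dim H D" "\<And>\<psi>. \<psi> \<in> perp H D \<Longrightarrow> 0 + \<psi> \<in> U"
    using U(1) unfolding dual_open_def by blast
  obtain B where B: "finite B" "D = span B" using D(1) by (auto simp: fin_dim_def)
  define P where "P b F \<longleftrightarrow> finite F \<and> (\<forall>\<xi>. lin_form H \<xi> \<longrightarrow>
      (\<forall>(l, s)\<in>F. \<forall>d\<in>coeff_space m n H x l s. \<xi> d = 0) \<longrightarrow> \<xi> b = 0)" for b F
  have "\<exists>F. P b F" for b
    unfolding P_def by (rule coeff_spaces_detect[OF alg_UNIV[OF two]])
  then obtain F where P: "\<And>b. P b (F b)" by metis
  have F: "finite (F b)"
    "lin_form H \<xi> \<Longrightarrow> (\<forall>(l, s)\<in>F b. \<forall>d\<in>coeff_space m n H x l s. \<xi> d = 0) \<Longrightarrow> \<xi> b = 0"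
    for b \<xi> using P[of b] unfolding P_def by blast+
  \<comment> \<open>The pair \<open>(0, 0)\<close> keeps the family nonempty even when no vector of
    \<open>B\<close> contributes a pair, and it forces elements of the intersection to be
    distributions.\<close>
  define G where "G = insert (0, 0) (\<Union>b\<in>B. F b)"
  have "\<xi> \<in> I" if \<xi>: "\<xi> \<in> (\<Inter>(l, s)\<in>G. ker_pi m n H x l s)" for \<xi>
  proof -
    have k: "\<xi> \<in> ker_pi m n H x l s" if "(l, s) \<in> G" for l s using \<xi> that by blast
    have dist: "\<xi> \<in> Dist H" using k[of 0 0] by (simp add: G_def ker_pi_iff)
    then have lin: "lin_form H \<xi>" using Dist_dual by (auto simp: dual_def)
    have zero: "\<xi> b = 0" if "b \<in> B" for b
    proof (rule F(2)[OF lin, of b], clarify)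
      fix l s d assume "(l, s) \<in> F b" "d \<in> coeff_space m n H x l s"
      then show "\<xi> d = 0" using k[of l s] that by (auto simp: G_def ker_pi_iff)
    qed
    have "\<xi> d = 0" if "d \<in> span B" for d
      using that
    proof (induction rule: span_induct_alt)
      case base
      show ?case by (rule lin_form_zero[OF lin])
    next
      case (step k b d)
      then show ?case
        by (simp add: zero lin_form_add[OF lin] lin_form_scale[OF lin])
    qed
    then have "\<xi> \<in> perp H D" using lin by (simp add: perp_def dual_def B(2))
    then show ?thesis using D(2) dist U(2) by simp
  qed
  then show ?thesis using B(1) F(1) by (intro exI[of _ G]) (auto simp: G_def)
qed

text \<open>Once \<open>D\<close> contains all \<open>C\<close> spaces indexed by \<open>F\<close>,
  a distribution that annihilates \<open>D\<close> lies in every listed kernel and hence in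
  \<open>I\<close>.\<close>

lemma superideal_open:
  assumes I: "I \<subseteq> Dist H" "\<And>\<phi> \<psi>. \<phi> \<in> I \<Longrightarrow> \<psi> \<in> I \<Longrightarrow> \<phi> + \<psi> \<in> I"
    and F: "finite F" "(\<Inter>(l, s)\<in>F. ker_pi m n H x l s) \<subseteq> I"
  shows "openin (subtopology (dual_topology H) (Dist H)) I"
proof -
  have "finite (\<Union>(l, s)\<in>F. words l s)" using F(1) finite_words by auto
  then obtain D where D: "subsupercoalgebra H D" "fin_dim H D" "span (\<Union>(l, s)\<in>F. words l s) \<subseteq> D"
    using finite_dim_subsupercoalgebra_span by blast
  have CD: "coeff_space m n H x l s \<subseteq> D" if "(l, s) \<in> F" for l s
    unfolding coeff_space_words by (rule subset_trans[OF span_mono D(3)]) (use that in blast)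
  have perp_I: "\<psi> \<in> I" if "\<psi> \<in> perp H D" "\<psi> \<in> Dist H" for \<psi>
  proof -
    have "\<psi> \<in> ker_pi m n H x l s" if "(l, s) \<in> F" for l s
      using CD[OF that] \<open>\<psi> \<in> perp H D\<close> \<open>\<psi> \<in> Dist H\<close> by (auto simp: ker_pi_iff perp_def)
    then show ?thesis using F(2) by blast
  qed
  \<comment> \<open>This sum is stable under translation by the annihilator of \<open>D\<close>, so
    the same \<open>D\<close> witnesses openness at each of its points.\<close>
  define U where "U = {\<phi> + \<psi> | \<phi> \<psi>. \<phi> \<in> I \<and> \<psi> \<in> perp H D}"
  have "dual_open H U"
    unfolding dual_open_def
  proof (intro conjI ballI)
    show "U \<subseteq> dual H"
    proof
      fix \<chi> assume "\<chi> \<in> U"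
      then obtain \<phi> \<psi> where "\<chi> = \<phi> + \<psi>" "\<phi> \<in> I" "\<psi> \<in> perp H D" by (auto simp: U_def)
      moreover have "\<phi> \<in> dual H" using I(1) Dist_dual \<open>\<phi> \<in> I\<close> by blast
      moreover have "\<psi> \<in> dual H" using \<open>\<psi> \<in> perp H D\<close> by (simp add: perp_def)
      ultimately show "\<chi> \<in> dual H" using perp_add[of \<phi> "{}" \<psi>] by (simp add: dual_eq_perp)
    qed
    fix \<chi> assume "\<chi> \<in> U"
    then obtain \<phi> \<psi> where \<chi>: "\<chi> = \<phi> + \<psi>" "\<phi> \<in> I" "\<psi> \<in> perp H D" by (auto simp: U_def)
    have "\<chi> + \<psi>' \<in> U" if "\<psi>' \<in> perp H D" for \<psi>'
      using perp_add[OF \<chi>(3) that] \<chi> unfolding U_def by (auto simp: add.assoc)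
    then show "\<exists>D. subsupercoalgebra H D \<and> fin_dim H D \<and> (\<forall>\<psi>\<in>perp H D. \<chi> + \<psi> \<in> U)"
      using D by blast
  qed
  moreover have "I = U \<inter> Dist H"
  proof (intro equalityI subsetI)
    fix \<phi> assume \<phi>: "\<phi> \<in> I"
    have "0 \<in> perp H D"
      by (auto simp: perp_def dual_def intro!: lin_formI[OF vector_space_axioms])
    moreover have "\<phi> = \<phi> + 0" by simp
    ultimately have "\<phi> \<in> U" unfolding U_def using \<phi> by blast
    then show "\<phi> \<in> U \<inter> Dist H" using \<phi> I(1) by blast
  next
    fix \<chi> assume \<chi>: "\<chi> \<in> U \<inter> Dist H"
    then obtain \<phi> \<psi> where *: "\<chi> = \<phi> + \<psi>" "\<phi> \<in> I" "\<psi> \<in> perp H D" by (auto simp: U_def)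
    \<comment> \<open>The annihilator part is a difference of two distributions, so it is a
      distribution itself and \<open>perp_I\<close> applies.\<close>
    then have "\<psi> \<in> Dist H" using Dist_diff[of \<chi> \<phi>] \<chi> I(1) by auto
    then show "\<chi> \<in> I" using * I(2) perp_I by blast
  qed
  ultimately show ?thesis
    by (auto simp: openin_subtopology openin_dual_topology[OF supercoalgebra])
qed

end

theorem lemma10p1:
  fixes H :: "('k::field, 'a::ring_1) hopf_data"
    and m n p :: nat
    and x :: "nat \<Rightarrow> nat \<Rightarrow> 'a"
    and I :: "('a \<Rightarrow> 'k) set"
  assumes "CHAR('k) = p" and "p > 2"
    and "GL_coordinate_hopf_superalgebra m n H x"
    and "dual_superideal H (Dist H) I"
  shows "openin (subtopology (dual_topology H) (Dist H)) I \<longleftrightarrow>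
    (\<exists>F. finite F \<and> F \<noteq> {} \<and> (\<Inter>(l, s)\<in>F. ker_pi m n H x l s) \<subseteq> I)"
proof -
  interpret gl_coordinate m n H x by unfold_locales (rule assms(3))
  interpret D: vector_space "fscale :: 'k \<Rightarrow> ('a \<Rightarrow> 'k) \<Rightarrow> 'a \<Rightarrow> 'k" by (rule vector_space_fscale)
  have two: "(1 + 1 :: 'k) \<noteq> 0"
  proof
    assume "(1 + 1 :: 'k) = 0"
    then have "of_nat 2 = (0 :: 'k)" by simp
    then have "p dvd 2" unfolding of_nat_eq_0_iff_char_dvd assms(1) .
    then show False using assms(2) dvd_imp_le[of p 2] by simp
  qed
  have sub: "I \<subseteq> Dist H" and I: "D.subspace I" using assms(4) by (auto simp: dual_superideal_def)
  show ?thesis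
  proof
    assume "openin (subtopology (dual_topology H) (Dist H)) I"
    then show "\<exists>F. finite F \<and> F \<noteq> {} \<and> (\<Inter>(l, s)\<in>F. ker_pi m n H x l s) \<subseteq> I"
      by (rule open_superideal_contains[OF two D.subspace_0[OF I]])
  next
    assume "\<exists>F. finite F \<and> F \<noteq> {} \<and> (\<Inter>(l, s)\<in>F. ker_pi m n H x l s) \<subseteq> I"
    then show "openin (subtopology (dual_topology H) (Dist H)) I"
      using superideal_open[OF sub D.subspace_add[OF I]] by blast
  qed
qed

end
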